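(* Let $n\ge1$, let $U\subset S^{2n}$ be open, and let $f:U\to\mathcal J(S^{2n})\subset\mathcal J(\mathbb R^{2n+2})$ be a (smooth) local section of $\pi:\mathcal J(S^{2n})\to S^{2n}$, with associated almost complex structure $J_f$ on $U$. Then $f$, viewed as a map from $(U,J_f)$ to $(\mathcal J(\mathbb R^{2n+2}),\tilde J)$, is holomorphic (i.e. $\tilde J\circ f_*=f_*\circ J_f$) if and only if $f$ is a local section of $\widetilde{\mathcal J}(S^{2n})$ and is integrable, i.e. if and only if $J_f$ is orthogonal and integrable.
   Context: $\mathcal J(\mathbb R^{2n+2})=\{A\in GL(2n+2,\mathbb R) : A^2=-I\}$, a submanifold of $GL(2n+2,\mathbb R)$ with tangent space $T_A\mathcal J(\mathbb R^{2n+2})=\{X\in gl(2n+2,\mathbb R): AX=-XA\}$ at $A$, equipped with the complex structure $\tilde J X=AX$ for $X\in T_A\mathcal J(\mathbb R^{2n+2})$. Let $e_{-1}=(1,0,\dots,0)^t\in\mathbb R^{2n+2}$ and $S^{2n}=\{e_0\in\mathbb R^{2n+2}: |e_0|=1,\ e_0\perp e_{-1}\}$ with the standard round metric. $\mathcal J(S^{2n})$ is the set of $A\in\mathcal J(\mathbb R^{2n+2})$ such that $e_0:=Ae_{-1}\in S^{2n}$ and $Av\perp e_{-1},e_0$ for every $v\perp e_{-1},e_0$; the projection is $\pi(A)=Ae_{-1}$. $\widetilde{\mathcal J}(S^{2n})\subset\mathcal J(S^{2n})$ is the subspace of those $A$ with $A^t=-A$ (equivalently, whose restriction to $T_{e_0}S^{2n}=\{e_{-1},e_0\}^\perp$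 is orthogonal). A local section $f$ defines the almost complex structure $J_f$ on its domain by $J_fX=f(e_0)X$ for $X\in T_{e_0}S^{2n}=\{e_{-1},e_0\}^\perp$. "$f$ is integrable" means that the almost complex structure $J_f$ is integrable. Here $f_*$ denotes the differential of $f$. *)

theory Defs
  imports "HOL-Analysis.Analysis"
begin

(* With n = CARD('n) >= 1, real ^ 'n ix is R^(2n+2).  The coordinate -1 is None, the
   coordinate 0 is Some None, the remaining 2n coordinates are Some (Some _). *)
type_synonym 'n ix = "('n + 'n) option option"

lemma card_ix: "CARD('n::finite ix) = 2 * CARD('n) + 2"
  by (simp add: card_UNIV_option)

subsection \<open>Smooth maps\<close>

(* Used for open V only: all iterated directional derivatives up to order k exist
   (as derivatives of Frechet differentiable maps) and are continuous. *)
primrec Ck_on ::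
    "nat \<Rightarrow> 'a::euclidean_space set \<Rightarrow> ('a \<Rightarrow> 'b::euclidean_space) \<Rightarrow> bool" where
  "Ck_on 0 V F \<longleftrightarrow> continuous_on V F"
| "Ck_on (Suc k) V F \<longleftrightarrow>
     F differentiable_on V \<and> (\<forall>v. Ck_on k V (\<lambda>x. frechet_derivative F (at x) v))"

(* The usual notion for maps on a subset M of a Euclidean space: locally the restriction of a
   C-infinity map on an open subset of the ambient space.  For embedded submanifolds this is
   smoothness in the sense of manifolds, for open M it is C-infinity on M. *)
definition smooth_on ::
    "'a::euclidean_space set \<Rightarrow> ('a \<Rightarrow> 'b::euclidean_space) \<Rightarrow> bool" where
  "smooth_on M f \<longleftrightarrow>
     (\<forall>x\<in>M. \<exists>V F. open V \<and> x \<in> V \<and> (\<forall>k. Ck_on k V F) \<and> (\<forall>y\<in>M \<inter> V. F y = f y))"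

subsection \<open>The sphere\<close>

definition e_neg :: "real ^ 'n::finite ix" where
  "e_neg = axis None 1"

definition S2n :: "(real ^ 'n::finite ix) set" where
  "S2n = {x. norm x = 1 \<and> orthogonal x e_neg}"

definition TS :: "real ^ 'n::finite ix \<Rightarrow> (real ^ 'n ix) set" where
  "TS p = {X. orthogonal X e_neg \<and> orthogonal X p}"

(* The differential at p of a map f on a relatively open U in S2n.  The Frechet derivative of
   f relative to U is not unique as a linear map on the ambient space, but its values on TS p
   are; see differential_eqI and smooth_on_has_derivative below. *)
definition differential ::
    "(real ^ 'n::finite ix) set \<Rightarrow> (real ^ 'n ix \<Rightarrow> 'b::euclidean_space) \<Rightarrow>
     real ^ 'n ix \<Rightarrow> real ^ 'n ix \<Rightarrow> 'b" where
  "differential U f p = frechet_derivative f (at p within U)"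

subsection \<open>The complex structures\<close>

definition JR :: "(real ^ 'm::finite ^ 'm) set" where
  "JR = {A. invertible A \<and> A ** A = - mat 1}"

definition JR_tilde :: "real ^ 'm::finite ^ 'm \<Rightarrow> real ^ 'm ^ 'm \<Rightarrow> real ^ 'm ^ 'm" where
  "JR_tilde A X = A ** X"

definition proj_J :: "real ^ 'n::finite ix ^ 'n ix \<Rightarrow> real ^ 'n ix" where
  "proj_J A = A *v e_neg"

definition JS :: "(real ^ 'n::finite ix ^ 'n ix) set" where
  "JS = {A \<in> JR. proj_J A \<in> S2n \<and>
          (\<forall>v. orthogonal v e_neg \<and> orthogonal v (proj_J A) \<longrightarrow>
               orthogonal (A *v v) e_neg \<and> orthogonal (A *v v) (proj_J A))}"

definition JS_tilde :: "(real ^ 'n::finite ix ^ 'n ix) set" where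
  "JS_tilde = {A \<in> JS. transpose A = - A}"

definition local_section ::
    "(real ^ 'n::finite ix ^ 'n ix) set \<Rightarrow> (real ^ 'n ix) set \<Rightarrow>
     (real ^ 'n ix \<Rightarrow> real ^ 'n ix ^ 'n ix) \<Rightarrow> bool" where
  "local_section E U f \<longleftrightarrow>
     smooth_on U f \<and> (\<forall>p\<in>U. f p \<in> E \<and> proj_J (f p) = p)"

definition J_of ::
    "(real ^ 'n::finite ix \<Rightarrow> real ^ 'n ix ^ 'n ix) \<Rightarrow> real ^ 'n ix \<Rightarrow>
     real ^ 'n ix \<Rightarrow> real ^ 'n ix" where
  "J_of f p X = f p *v X"

definition holomorphic_section ::
    "(real ^ 'n::finite ix) set \<Rightarrow> (real ^ 'n ix \<Rightarrow> real ^ 'n ix ^ 'n ix) \<Rightarrow> bool" where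
  "holomorphic_section U f \<longleftrightarrow>
     (\<forall>p\<in>U. \<forall>X\<in>TS p.
        JR_tilde (f p) (differential U f p X) = differential U f p (J_of f p X))"

definition orthogonal_acs ::
    "(real ^ 'n::finite ix) set \<Rightarrow> (real ^ 'n ix \<Rightarrow> real ^ 'n ix \<Rightarrow> real ^ 'n ix) \<Rightarrow> bool" where
  "orthogonal_acs U J \<longleftrightarrow> (\<forall>p\<in>U. \<forall>X\<in>TS p. \<forall>Y\<in>TS p. J p X \<bullet> J p Y = X \<bullet> Y)"

(* J is induced by a complex manifold structure on U: every point has a smooth chart to an
   open set of C^n which identifies J with multiplication by i.  The transition maps between
   such charts have complex linear differentials, so the charts form a holomorphic atlas. *)
definition integrable_acs ::
    "(real ^ 'n::finite ix) set \<Rightarrow> (real ^ 'n ix \<Rightarrow> real ^ 'n ix \<Rightarrow> real ^ 'n ix) \<Rightarrow> bool" where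
  "integrable_acs U J \<longleftrightarrow>
     (\<forall>p\<in>U. \<exists>V (W :: (complex ^ 'n) set) \<phi> \<psi>.
        openin (top_of_set U) V \<and> p \<in> V \<and> open W \<and>
        homeomorphism V W \<phi> \<psi> \<and> smooth_on V \<phi> \<and> smooth_on W \<psi> \<and>
        (\<forall>q\<in>V. \<forall>X\<in>TS q. differential V \<phi> q (J q X) = \<i> *s differential V \<phi> q X))"

subsection \<open>The differential is well defined on tangent vectors\<close>

lemma smooth_on_has_derivative:
  assumes "smooth_on U f" "p \<in> U"
  shows "(f has_derivative differential U f p) (at p within U)"
proof -
  obtain V F where V: "open V" "p \<in> V" "\<forall>k. Ck_on k V F" and eq: "\<forall>y\<in>U \<inter> V. F y = f y"
    using assms unfolding smooth_on_def by blast
  have "F differentiable_on V"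
    using V(3) Ck_on.simps(2) by blast
  then have "F differentiable (at p)"
    using V by (metis at_within_open differentiable_on_def)
  then obtain D where "(F has_derivative D) (at p within U)"
    using differentiable_def has_derivative_at_withinI by blast
  moreover obtain e where "e > 0" "ball p e \<subseteq> V"
    using V openE by blast
  ultimately have "(f has_derivative D) (at p within U)"
    using eq assms(2)
    by (elim has_derivative_transform_within[where d = e]) (auto simp: subset_iff dist_commute)
  then show ?thesis
    unfolding differential_def using differentiableI frechet_derivative_works by blast
qed

lemma differential_eqI:
  assumes U: "openin (top_of_set S2n) U" "p \<in> U" and X: "X \<in> TS p"
    and D: "(f has_derivative D) (at p within U)"
  shows "differential U f p X = D X"
proof (cases "X = 0")
  case True
  have "(f has_derivative differential U f p) (at p within U)"
    unfolding differential_def using D differentiableI frechet_derivative_works by blast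
  then show ?thesis
    using True linear_0[OF has_derivative_linear] D by metis
next
  case False
  define g where "g t = cos (norm X * t) *\<^sub>R p + (sin (norm X * t) / norm X) *\<^sub>R X" for t
  obtain O' where O': "open O'" "U = S2n \<inter> O'"
    using U(1) openin_open by metis
  have p: "p \<bullet> p = 1" "p \<bullet> e_neg = 0"
    using U(2) O' by (auto simp: S2n_def orthogonal_def norm_eq_1)
  have X': "X \<bullet> p = 0" "p \<bullet> X = 0" "X \<bullet> e_neg = 0"
    using X by (auto simp: TS_def orthogonal_def inner_commute)
  have sphere: "g t \<in> S2n" for t
  proof -
    have "(a *\<^sub>R p + b *\<^sub>R X) \<bullet> (a *\<^sub>R p + b *\<^sub>R X) = a\<^sup>2 + b\<^sup>2 * (norm X)\<^sup>2" for a b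
      unfolding power2_norm_eq_inner inner_add inner_scaleR p X'
      by (simp add: power2_eq_square)
    then have "g t \<bullet> g t = (cos (norm X * t))\<^sup>2 + (sin (norm X * t))\<^sup>2"
      unfolding g_def using False by (simp only:) (simp add: power_divide)
    then have "g t \<bullet> g t = 1"
      by simp
    moreover have "g t \<bullet> e_neg = 0"
      using p X' by (simp add: g_def inner_add)
    ultimately show ?thesis
      by (simp add: S2n_def orthogonal_def norm_eq_1)
  qed
  have g0: "g 0 = p" by (simp add: g_def)
  have dg: "(g has_vector_derivative X) (at 0)"
    unfolding g_def using False
    by (auto intro!: derivative_eq_intros simp: has_vector_derivative_def)
  define T where "T = g -` O'"
  have "continuous_on UNIV g"
    unfolding g_def using False by (intro continuous_intros) auto
  then have T: "open T" "0 \<in> T"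
    using O' U(2) g0 by (auto simp: T_def continuous_on_open_vimage)
  have gT: "g ` T \<subseteq> U"
    using sphere O' by (auto simp: T_def)
  have dg': "(g has_derivative (\<lambda>t. t *\<^sub>R X)) (at 0 within T)"
    using dg unfolding has_vector_derivative_def by (rule has_derivative_at_withinI)
  have key: "((f \<circ> g) has_vector_derivative E X) (at 0)"
    if E: "(f has_derivative E) (at p within U)" for E
  proof -
    have "(f has_derivative E) (at (g 0) within g ` T)"
      unfolding g0 using E gT by (rule has_derivative_subset)
    then have "((f \<circ> g) has_derivative (E \<circ> (\<lambda>t. t *\<^sub>R X))) (at 0 within T)"
      by (rule diff_chain_within[OF dg'])
    moreover have "E \<circ> (\<lambda>t. t *\<^sub>R X) = (\<lambda>t. t *\<^sub>R E X)"
      using linear_cmul[OF has_derivative_linear[OF E]] by (simp add: fun_eq_iff)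
    ultimately show ?thesis
      using T by (simp only: has_vector_derivative_def at_within_open)
  qed
  have "(f has_derivative differential U f p) (at p within U)"
    unfolding differential_def using D differentiableI frechet_derivative_works by blast
  from vector_derivative_unique_at[OF key[OF this] key[OF D]] show ?thesis .
qed

end

theory Submission
  imports Defs
begin

text \<open>Write \<open>A = f p\<close>, \<open>e = e\<^sub>-\<^sub>1\<close> and \<open>B\<^sub>X = f\<^sub>* X\<close>.  Differentiating \<open>A e = p\<close>, \<open>\<langle>A v, e\<rangle> = - \<langle>v, p\<rangle>\<close> and
  \<open>\<langle>A v, p\<rangle> = \<langle>v, e\<rangle>\<close> determines the \<open>e\<close>- and \<open>p\<close>-components of \<open>B\<^sub>X\<close>; for holomorphic \<open>f\<close> comparing those
  of \<open>B\<^bsub>A X\<^esub>\<close> and \<open>A B\<^sub>X\<close> forces \<open>A\<close> to be skew.  Moreover the image of a holomorphic section is an almost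
  complex submanifold of a complex manifold, and complex linear projection of it in a complex
  chart yields holomorphic coordinates on \<open>U\<close>, so Newlander-Nirenberg is not needed.
  Conversely, let \<open>f\<close> be orthogonal and integrable and put \<open>N(X) = B\<^bsub>A X\<^esub> - A B\<^sub>X\<close>.  Differentiating the
  Cauchy-Riemann equation of a holomorphic parametrization shows \<open>N(X) Y = N(Y) X\<close>; since \<open>N(X)\<close> is
  also skew and kills \<open>e\<close> and \<open>p\<close>, it vanishes.\<close>

subsection \<open>Calculus of \<open>C\<^sup>k\<close> maps\<close>

lemma Ck_on_cong:
  assumes "open V" "\<And>x. x \<in> V \<Longrightarrow> F x = G x" "Ck_on k V F"
  shows "Ck_on k V G"
  using assms(2,3)
proof (induction k arbitrary: F G)
  case 0
  then show ?case by (metis Ck_on.simps(1) continuous_on_cong)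
next
  case (Suc k)
  have D: "(G has_derivative frechet_derivative F (at x)) (at x)" if "x \<in> V" for x
  proof (rule has_derivative_transform_within_open[OF _ assms(1) that])
    show "(F has_derivative frechet_derivative F (at x)) (at x)"
      using Suc.prems(2) that assms(1)
      by (metis Ck_on.simps(2) at_within_open differentiable_on_def frechet_derivative_works)
  qed (use Suc.prems in auto)
  have "Ck_on k V (\<lambda>x. frechet_derivative G (at x) v)" for v
  proof (rule Suc.IH)
    show "Ck_on k V (\<lambda>x. frechet_derivative F (at x) v)" using Suc.prems by simp
    show "frechet_derivative F (at x) v = frechet_derivative G (at x) v" if "x \<in> V" for x
      using frechet_derivative_at[OF D[OF that]] by simp
  qed
  moreover have "G differentiable_on V"
    unfolding differentiable_on_def using D differentiableI differentiable_at_withinI by blast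
  ultimately show ?case by simp
qed

text \<open>Working introduction rule: the derivative may be any explicit formula \<open>F'\<close>
  valid on \<open>V\<close>; \<open>Ck_on_cong\<close> trades it for the chosen
  \<open>frechet_derivative\<close>.\<close>

lemma Ck_on_SucI:
  assumes "open V" "\<And>x. x \<in> V \<Longrightarrow> (F has_derivative F' x) (at x)"
    and "\<And>v. Ck_on k V (\<lambda>x. F' x v)"
  shows "Ck_on (Suc k) V F"
proof -
  have "F differentiable_on V"
    unfolding differentiable_on_def using assms(2) differentiableI differentiable_at_withinI by blast
  moreover have "Ck_on k V (\<lambda>x. frechet_derivative F (at x) v)" for v
    by (rule Ck_on_cong[OF assms(1) _ assms(3)[of v]]) (use frechet_derivative_at[OF assms(2)] in simp)
  ultimately show ?thesis by simp
qed

lemma Ck_on_has_derivative: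
  assumes "open V" "Ck_on (Suc k) V F" "x \<in> V"
  shows "(F has_derivative frechet_derivative F (at x)) (at x)"
  using assms by (metis Ck_on.simps(2) at_within_open differentiable_on_def frechet_derivative_works)

lemma Ck_on_derivative:
  "Ck_on (Suc k) V F \<Longrightarrow> Ck_on k V (\<lambda>x. frechet_derivative F (at x) v)"
  by simp

lemma Ck_on_Suc_imp: "Ck_on (Suc k) V F \<Longrightarrow> Ck_on k V F"
proof (induction k arbitrary: F)
  case 0
  then show ?case by (simp add: differentiable_imp_continuous_on)
next
  case (Suc k)
  then show ?case by (metis Ck_on.simps(2))
qed

lemma Ck_on_subset: "open V \<Longrightarrow> open W \<Longrightarrow> W \<subseteq> V \<Longrightarrow> Ck_on k V F \<Longrightarrow> Ck_on k W F"
  by (induction k arbitrary: F) (auto intro: continuous_on_subset differentiable_on_subset)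

lemma Ck_on_const: "Ck_on k V (\<lambda>x. c)"
  by (induction k arbitrary: c) auto

lemma Ck_on_linear:
  assumes "open V" "linear L"
  shows "Ck_on k V L"
proof (cases k)
  case 0
  then show ?thesis using assms(2) by (simp add: linear_continuous_on linear_linear)
next
  case (Suc j)
  show ?thesis unfolding Suc
    by (rule Ck_on_SucI[OF assms(1), where F' = "\<lambda>_. L"])
      (use assms(2) in \<open>auto simp: bounded_linear_imp_has_derivative linear_linear Ck_on_const\<close>)
qed

lemma Ck_on_linear_compose:
  assumes "open V" "linear L" "Ck_on k V F"
  shows "Ck_on k V (\<lambda>x. L (F x))"
  using assms(3)
proof (induction k arbitrary: F)
  case 0
  then show ?case
    using assms(2) linear_continuous_on_compose by auto
next
  case (Suc k)
  show ?case
  proof (rule Ck_on_SucI[OF assms(1)])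
    show "((\<lambda>x. L (F x)) has_derivative (\<lambda>v. L (frechet_derivative F (at x) v))) (at x)"
      if "x \<in> V" for x
      using Ck_on_has_derivative[OF assms(1) Suc.prems that] assms(2)
      by (simp add: bounded_linear.has_derivative linear_linear)
  qed (use Suc in auto)
qed

lemma Ck_on_add:
  assumes "open V" "Ck_on k V F" "Ck_on k V G"
  shows "Ck_on k V (\<lambda>x. F x + G x)"
  using assms(2,3)
proof (induction k arbitrary: F G)
  case 0
  then show ?case by (simp add: continuous_on_add)
next
  case (Suc k)
  show ?case
  proof (rule Ck_on_SucI[OF assms(1)])
    show "((\<lambda>x. F x + G x) has_derivative
        (\<lambda>v. frechet_derivative F (at x) v + frechet_derivative G (at x) v)) (at x)"
      if "x \<in> V" for x
      by (rule has_derivative_add; rule Ck_on_has_derivative[OF assms(1) _ that])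
        (use Suc.prems in auto)
  qed (use Suc in auto)
qed

lemma Ck_on_sum:
  assumes "open V" "\<And>i. i \<in> I \<Longrightarrow> Ck_on k V (F i)"
  shows "Ck_on k V (\<lambda>x. \<Sum>i\<in>I. F i x)"
  using assms(2)
  by (induction I rule: infinite_finite_induct) (auto simp: Ck_on_const intro!: Ck_on_add[OF assms(1)])

lemma Ck_on_bilinear:
  assumes "open V" "bounded_bilinear B" "Ck_on k V F" "Ck_on k V G"
  shows "Ck_on k V (\<lambda>x. B (F x) (G x))"
  using assms(3,4)
proof (induction k arbitrary: F G)
  case 0
  then show ?case using bounded_bilinear.continuous_on[OF assms(2)] by auto
next
  case (Suc k)
  show ?case
  proof (rule Ck_on_SucI[OF assms(1)])
    show "((\<lambda>x. B (F x) (G x)) has_derivative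
        (\<lambda>v. B (F x) (frechet_derivative G (at x) v) + B (frechet_derivative F (at x) v) (G x))) (at x)"
      if "x \<in> V" for x
      by (rule bounded_bilinear.FDERIV[OF assms(2)]; rule Ck_on_has_derivative[OF assms(1) _ that])
        (use Suc.prems in auto)
    show "Ck_on k V (\<lambda>x. B (F x) (frechet_derivative G (at x) v) +
        B (frechet_derivative F (at x) v) (G x))" for v
      by (intro Ck_on_add[OF assms(1)] Suc.IH Ck_on_derivative Suc.prems Ck_on_Suc_imp[OF Suc.prems(1)]
          Ck_on_Suc_imp[OF Suc.prems(2)])
  qed
qed

lemma Ck_on_prod:
  fixes F :: "'i \<Rightarrow> 'a::euclidean_space \<Rightarrow> real"
  assumes "open V" "\<And>i. i \<in> I \<Longrightarrow> Ck_on k V (F i)"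
  shows "Ck_on k V (\<lambda>x. \<Prod>i\<in>I. F i x)"
  using assms(2)
  by (induction I rule: infinite_finite_induct)
    (auto simp: Ck_on_const intro!: Ck_on_bilinear[OF assms(1) bounded_bilinear_mult])

text \<open>The derivative is a product of the derivative of \<open>F\<close> with two copies of the
  inverse itself, so regularity bootstraps along \<open>k\<close>. Writing the sign as a factor
  \<open>- 1\<close> lets the product rule cover it.\<close>

lemma Ck_on_inverse:
  fixes F :: "'a::euclidean_space \<Rightarrow> real"
  assumes "open V" "Ck_on k V F" "\<And>x. x \<in> V \<Longrightarrow> F x \<noteq> 0"
  shows "Ck_on k V (\<lambda>x. inverse (F x))"
  using assms(2)
proof (induction k)
  case 0
  then show ?case using assms(3) by (auto intro: continuous_on_inverse)
next
  case (Suc k)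
  note M = Ck_on_bilinear[OF assms(1) bounded_bilinear_mult]
  show ?case
  proof (rule Ck_on_SucI[OF assms(1)])
    show "((\<lambda>x. inverse (F x)) has_derivative
        (\<lambda>v. - 1 * (inverse (F x) * frechet_derivative F (at x) v * inverse (F x)))) (at x)"
      if "x \<in> V" for x
      using Ck_on_has_derivative[OF assms(1) Suc.prems that] assms(3)[OF that]
      by (auto intro!: derivative_eq_intros)
    show "Ck_on k V (\<lambda>x. - 1 * (inverse (F x) * frechet_derivative F (at x) v * inverse (F x)))" for v
      by (intro M Suc.IH Ck_on_derivative Ck_on_const Suc.prems Ck_on_Suc_imp[OF Suc.prems])
  qed
qed

lemma Ck_on_euclidean_iff:
  assumes "open V"
  shows "Ck_on k V F \<longleftrightarrow> (\<forall>b\<in>Basis. Ck_on k V (\<lambda>x. F x \<bullet> b))"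
proof
  show "\<forall>b\<in>Basis. Ck_on k V (\<lambda>x. F x \<bullet> b)" if "Ck_on k V F"
    using Ck_on_linear_compose[OF assms bounded_linear.linear[OF bounded_linear_inner_left] that] by simp
next
  assume "\<forall>b\<in>Basis. Ck_on k V (\<lambda>x. F x \<bullet> b)"
  then have "Ck_on k V (\<lambda>x. (F x \<bullet> b) *\<^sub>R b)" if "b \<in> Basis" for b
    using that by (intro Ck_on_bilinear[OF assms bounded_bilinear_scaleR] Ck_on_const) auto
  from Ck_on_sum[where I = Basis and F = "\<lambda>b x. (F x \<bullet> b) *\<^sub>R b", OF assms this]
  show "Ck_on k V F" by (simp add: euclidean_representation)
qed

text \<open>In the chain rule both the base point and the direction of the derivative of
  \<open>G\<close> move with \<open>x\<close>, so the induction hypothesis does not apply directly.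
  Expanding the direction in \<open>Basis\<close> leaves scalar coefficients and terms with a fixed
  direction \<open>b\<close>, which are compositions of lower order.\<close>

lemma Ck_on_compose:
  assumes "open V" "open W" "F ` V \<subseteq> W" "Ck_on k V F" "Ck_on k W G"
  shows "Ck_on k V (\<lambda>x. G (F x))"
  using assms(4,5)
proof (induction k arbitrary: G)
  case 0
  then show ?case using assms(3) continuous_on_compose2 by auto
next
  case (Suc k)
  have D: "((\<lambda>x. G (F x)) has_derivative
        (\<lambda>v. frechet_derivative G (at (F x)) (frechet_derivative F (at x) v))) (at x)"
      if "x \<in> V" for x
    using has_derivative_compose[OF Ck_on_has_derivative[OF assms(1) Suc.prems(1) that]
        Ck_on_has_derivative[OF assms(2) Suc.prems(2)]] assms(3) that by auto
  have E: "frechet_derivative G (at (F x)) (frechet_derivative F (at x) v) =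
      (\<Sum>b\<in>Basis. (frechet_derivative F (at x) v \<bullet> b) *\<^sub>R frechet_derivative G (at (F x)) b)"
      if "x \<in> V" for x v
  proof -
    have L: "linear (frechet_derivative G (at (F x)))"
      using assms(3) that by (intro has_derivative_linear[OF Ck_on_has_derivative[OF assms(2) Suc.prems(2)]]) auto
    show ?thesis
      by (subst euclidean_representation[symmetric, of "frechet_derivative F (at x) v"])
        (simp only: linear_sum[OF L] linear_cmul[OF L])
  qed
  show ?case
  proof (rule Ck_on_SucI[OF assms(1)])
    show "((\<lambda>x. G (F x)) has_derivative (\<lambda>v.
      (\<Sum>b\<in>Basis. (frechet_derivative F (at x) v \<bullet> b) *\<^sub>R frechet_derivative G (at (F x)) b))) (at x)"
      if "x \<in> V" for x
      using D[OF that] E[OF that] by simp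
    show "Ck_on k V (\<lambda>x. \<Sum>b\<in>Basis. (frechet_derivative F (at x) v \<bullet> b) *\<^sub>R
        frechet_derivative G (at (F x)) b)" for v
    proof (intro Ck_on_sum[OF assms(1)] Ck_on_bilinear[OF assms(1) bounded_bilinear_scaleR])
      show "Ck_on k V (\<lambda>x. frechet_derivative F (at x) v \<bullet> b)" if "b \<in> Basis" for b
        using that by (rule bspec[OF iffD1[OF Ck_on_euclidean_iff[OF assms(1)] Ck_on_derivative[OF Suc.prems(1)]]])
      show "Ck_on k V (\<lambda>x. frechet_derivative G (at (F x)) b)" for b
        by (rule Suc.IH[OF Ck_on_Suc_imp[OF Suc.prems(1)] Ck_on_derivative[OF Suc.prems(2)]])
    qed
  qed
qed

section \<open>Vector and matrix valued maps\<close>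

lemma Ck_on_vec_nth:
  fixes F :: "'a::euclidean_space \<Rightarrow> 'b::euclidean_space ^ 'm::finite"
  assumes "open V" "Ck_on k V F"
  shows "Ck_on k V (\<lambda>x. F x $ i)"
  by (rule Ck_on_linear_compose[OF assms(1) bounded_linear.linear[OF bounded_linear_vec_nth] assms(2)])

lemma Ck_on_vecI:
  fixes F :: "'a::euclidean_space \<Rightarrow> real ^ 'm::finite"
  assumes "open V" "\<And>i. Ck_on k V (\<lambda>x. F x $ i)"
  shows "Ck_on k V F"
proof (subst Ck_on_euclidean_iff[OF assms(1)], rule ballI)
  fix b :: "real ^ 'm" assume "b \<in> Basis"
  then obtain i where "b = axis i 1" by (auto simp: Basis_vec_def)
  then have "(\<lambda>x. F x \<bullet> b) = (\<lambda>x. F x $ i)" by (simp add: inner_axis)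
  then show "Ck_on k V (\<lambda>x. F x \<bullet> b)" using assms(2)[of i] by (simp only:)
qed

lemma Ck_on_det:
  fixes M :: "'a::euclidean_space \<Rightarrow> real ^ 'm::finite ^ 'm"
  assumes "open V" "\<And>i j. Ck_on k V (\<lambda>x. M x $ i $ j)"
  shows "Ck_on k V (\<lambda>x. det (M x))"
  unfolding det_def
  by (intro Ck_on_sum[OF assms(1)] Ck_on_bilinear[OF assms(1) bounded_bilinear_mult] Ck_on_const
      Ck_on_prod[OF assms(1)] assms(2))

text \<open>Cramer's rule writes the components of \<open>w\<close> as quotients of determinants in
  the entries of \<open>M\<close> and \<open>c\<close>. Hence a pointwise solution, even one
  obtained by choice, inherits their regularity.\<close>

lemma Ck_on_linear_solve:
  fixes M :: "'a::euclidean_space \<Rightarrow> real ^ 'm::finite ^ 'm"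
  assumes "open V" "\<And>i j. Ck_on k V (\<lambda>x. M x $ i $ j)" "Ck_on k V c"
    and "\<And>x. x \<in> V \<Longrightarrow> det (M x) \<noteq> 0" "\<And>x. x \<in> V \<Longrightarrow> M x *v w x = c x"
  shows "Ck_on k V w"
proof (rule Ck_on_cong[OF assms(1)])
  show "(\<chi> l. det (\<chi> i j. if j = l then c x $ i else M x $ i $ j) * inverse (det (M x))) = w x"
    if "x \<in> V" for x
    using cramer[OF assms(4)[OF that], of "w x" "c x"] assms(5)[OF that] by (simp add: divide_inverse)
  have e: "Ck_on k V (\<lambda>x. (\<chi> i j. if j = l then c x $ i else M x $ i $ j) $ i $ j)" for i j l
    using assms(2) Ck_on_vec_nth[OF assms(1,3)] by (cases "j = l") auto
  show "Ck_on k V (\<lambda>x. \<chi> l. det (\<chi> i j. if j = l then c x $ i else M x $ i $ j) * inverse (det (M x)))"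
    by (rule Ck_on_vecI[OF assms(1)], simp only: vec_lambda_beta)
      (intro Ck_on_bilinear[OF assms(1) bounded_bilinear_mult] Ck_on_det[OF assms(1)] e assms(2,4)
        Ck_on_inverse[OF assms(1)])
qed

section \<open>Smooth inverse function theorem\<close>

lemma linear_eq_matrix:
  fixes L :: "real ^ 'm::finite \<Rightarrow> real ^ 'm"
  assumes "linear L" shows "matrix L *v x = L x"
  using matrix_works[of L x] assms by (simp add: linear_matrix_vector_mul_eq)

text \<open>The C^1 theorem supplies \<open>G\<close>, and its smoothness is bootstrapped:
  \<open>G' y v\<close> solves the linear system with matrix \<open>D (G y)\<close> and right-hand
  side \<open>v\<close>. If \<open>G\<close> is C^k, so is this matrix, hence so is
  \<open>G' y v\<close>, and \<open>G\<close> is C^(k+1).\<close>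

lemma smooth_inverse_function:
  fixes F :: "real ^ 'm::finite \<Rightarrow> real ^ 'm"
  assumes V: "open V" "x0 \<in> V" and F: "\<And>k. Ck_on k V F"
    and inj: "inj (frechet_derivative F (at x0))"
  obtains V' W G where "open V'" "V' \<subseteq> V" "x0 \<in> V'" "open W" "homeomorphism V' W F G"
    "\<And>k. Ck_on k W G"
proof -
  define D where "D x = frechet_derivative F (at x)" for x
  have hD: "(F has_derivative D x) (at x)" if "x \<in> V" for x
    unfolding D_def using Ck_on_has_derivative[OF V(1) F that] .
  have linD: "bounded_linear (D x)" if "x \<in> V" for x
    using hD[OF that] has_derivative_bounded_linear by blast
  define B where "B x = Blinfun (D x)" for x
  have B: "blinfun_apply (B x) = D x" if "x \<in> V" for x
    unfolding B_def using linD[OF that] bounded_linear_Blinfun_apply by blast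
  \<comment> \<open>Continuity in operator norm is required; in finite dimension it follows from
    continuity in each fixed direction.\<close>
  have contB: "continuous_on V B"
  proof (rule continuous_on_blinfun_componentwise)
    fix i :: "real ^ 'm"
    have "continuous_on V (\<lambda>x. D x i)"
      using F[of "Suc 0"] by (simp add: D_def)
    then show "continuous_on V (\<lambda>x. blinfun_apply (B x) i)"
      using B by (simp cong: continuous_on_cong)
  qed
  obtain L where L: "linear L" "L \<circ> D x0 = id"
    using linear_injective_left_inverse[of "D x0"] inj linD[OF V(2)] bounded_linear.linear
    unfolding D_def by blast
  have "Blinfun L o\<^sub>L B x0 = id_blinfun"
    using L B[OF V(2)]
    by (intro blinfun_eqI) (simp add: bounded_linear_Blinfun_apply linear_linear pointfree_idE)
  then obtain V' W G G' where *: "open V'" "V' \<subseteq> V" "x0 \<in> V'" "open W" "homeomorphism V' W F G"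
    "\<And>y. y \<in> W \<Longrightarrow> (G has_derivative (G' y)) (at y)"
    "\<And>y. y \<in> W \<Longrightarrow> G' y = inv (blinfun_apply (B (G y)))"
    "\<And>y. y \<in> W \<Longrightarrow> bij (blinfun_apply (B (G y)))"
    using inverse_function_theorem[OF V(1) _ contB V(2), where f = F] hD B by metis
  have GV: "G y \<in> V" if "y \<in> W" for y
    using that *(2,5) unfolding homeomorphism_def by blast
  have "Ck_on k W G" for k
  proof (induction k)
    case 0
    then show ?case using *(5) by (simp add: homeomorphism_def)
  next
    case (Suc k)
    define M where "M y = matrix (D (G y))" for y
    have Mv: "M y *v x = D (G y) x" if "y \<in> W" for x y
      unfolding M_def using linD[OF GV[OF that]] by (simp add: linear_eq_matrix bounded_linear.linear)
    show ?case
    proof (rule Ck_on_SucI[OF *(4) *(6)])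
      fix v
      show "Ck_on k W (\<lambda>y. G' y v)"
      proof (rule Ck_on_linear_solve[OF *(4)])
        show "Ck_on k W (\<lambda>y. M y $ i $ j)" for i j
        proof -
          have "Ck_on k V (\<lambda>x. D x (axis j 1))"
            unfolding D_def using F[of "Suc k"] by simp
          then have "Ck_on k W (\<lambda>y. D (G y) (axis j 1))"
            using Ck_on_compose[OF *(4) V(1) _ Suc] GV by blast
          then have "Ck_on k W (\<lambda>y. D (G y) (axis j 1) $ i)"
            by (rule Ck_on_vec_nth[OF *(4)])
          then show ?thesis unfolding M_def matrix_def by simp
        qed
        show "Ck_on k W (\<lambda>y. v)" by (rule Ck_on_const)
        show "det (M y) \<noteq> 0" if "y \<in> W" for y
        proof -
          have "(*v) (M y) = blinfun_apply (B (G y))"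
            using B[OF GV[OF that]] Mv[OF that] by auto
          then have "inj ((*v) (M y))"
            using *(8)[OF that] by (simp add: bij_is_inj)
          then show ?thesis
            by (metis invertible_det_nz invertible_left_inverse matrix_left_invertible_injective)
        qed
        show "M y *v G' y v = v" if "y \<in> W" for y
          using *(7,8)[OF that] B[OF GV[OF that]] Mv[OF that] by (simp add: bij_is_surj surj_f_inv_f)
      qed
    qed
  qed
  then show ?thesis using that *(1-5) by blast
qed

subsection \<open>Symmetry of second derivatives\<close>

lemma has_real_derivative_along_line:
  fixes G :: "'a::real_normed_vector \<Rightarrow> real"
  assumes "(G has_derivative D) (at (x + s *\<^sub>R v))"
  shows "((\<lambda>s. G (x + s *\<^sub>R v)) has_real_derivative D v) (at s)"
proof -
  have "((\<lambda>s. x + s *\<^sub>R v) has_derivative (\<lambda>t. t *\<^sub>R v)) (at s)"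
    by (auto intro!: derivative_eq_intros)
  from has_derivative_compose[OF this assms]
  have "((\<lambda>s. G (x + s *\<^sub>R v)) has_derivative (\<lambda>t. D (t *\<^sub>R v))) (at s)" .
  moreover have "(\<lambda>t. D (t *\<^sub>R v)) = (*) (D v)"
    using linear_cmul[OF has_derivative_linear[OF assms]] by (auto simp: mult.commute)
  ultimately show ?thesis by (simp add: has_field_derivative_def)
qed

text \<open>The mean value theorem is applied twice: along \<open>v\<close> to the increment of
  \<open>G\<close> under the shift by \<open>r *\<^sub>R w\<close>, then along \<open>w\<close> to
  the derivative in direction \<open>v\<close>. The left-hand side is unchanged when
  \<open>v\<close> and \<open>w\<close> are swapped.\<close>

lemma second_difference_MVT:
  fixes G :: "'a::euclidean_space \<Rightarrow> real"
  assumes W: "open W" and G: "Ck_on (Suc (Suc 0)) W G" and r: "r > 0"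
    and sub: "\<And>s t. 0 \<le> s \<Longrightarrow> s \<le> r \<Longrightarrow> 0 \<le> t \<Longrightarrow> t \<le> r \<Longrightarrow> x + s *\<^sub>R v + t *\<^sub>R w \<in> W"
  obtains s t where "0 < s" "s < r" "0 < t" "t < r"
    "G (x + r *\<^sub>R v + r *\<^sub>R w) - G (x + r *\<^sub>R v) - G (x + r *\<^sub>R w) + G x =
     r\<^sup>2 * frechet_derivative (\<lambda>z. frechet_derivative G (at z) v) (at (x + s *\<^sub>R v + t *\<^sub>R w)) w"
proof -
  let ?D = "\<lambda>z. frechet_derivative G (at z) v"
  let ?H = "\<lambda>z. frechet_derivative ?D (at z) w"
  have D: "((\<lambda>s. G (x + s *\<^sub>R v + c *\<^sub>R w)) has_real_derivative ?D (x + s *\<^sub>R v + c *\<^sub>R w)) (at s)"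
    if "0 \<le> s" "s \<le> r" "0 \<le> c" "c \<le> r" for s c
  proof -
    have "(G has_derivative frechet_derivative G (at (x + c *\<^sub>R w + s *\<^sub>R v))) (at (x + c *\<^sub>R w + s *\<^sub>R v))"
      by (rule Ck_on_has_derivative[OF W G]) (use sub[OF that] in \<open>simp add: algebra_simps\<close>)
    from has_real_derivative_along_line[OF this] show ?thesis by (simp add: algebra_simps)
  qed
  have "\<exists>s>0. s < r \<and> (G (x + r *\<^sub>R v + r *\<^sub>R w) - G (x + r *\<^sub>R v + 0 *\<^sub>R w)) -
      (G (x + 0 *\<^sub>R v + r *\<^sub>R w) - G (x + 0 *\<^sub>R v + 0 *\<^sub>R w)) =
      (r - 0) * (?D (x + s *\<^sub>R v + r *\<^sub>R w) - ?D (x + s *\<^sub>R v + 0 *\<^sub>R w))"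
    by (rule MVT2[OF r]) (intro DERIV_diff D, use r in auto)
  then obtain s where s: "0 < s" "s < r"
    and s_eq: "G (x + r *\<^sub>R v + r *\<^sub>R w) - G (x + r *\<^sub>R v) - (G (x + r *\<^sub>R w) - G x) =
      r * (?D (x + s *\<^sub>R v + r *\<^sub>R w) - ?D (x + s *\<^sub>R v))" by auto
  have "\<exists>t>0. t < r \<and> ?D (x + s *\<^sub>R v + r *\<^sub>R w) - ?D (x + s *\<^sub>R v + 0 *\<^sub>R w) =
      (r - 0) * ?H (x + s *\<^sub>R v + t *\<^sub>R w)"
  proof (rule MVT2[OF r])
    fix t assume "0 \<le> t" "t \<le> r"
    then have "(?D has_derivative frechet_derivative ?D (at (x + s *\<^sub>R v + t *\<^sub>R w)))
        (at (x + s *\<^sub>R v + t *\<^sub>R w))"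
      using s by (intro Ck_on_has_derivative[OF W Ck_on_derivative[OF G]] sub) auto
    then show "((\<lambda>t. ?D (x + s *\<^sub>R v + t *\<^sub>R w)) has_real_derivative
        ?H (x + s *\<^sub>R v + t *\<^sub>R w)) (at t)"
      by (rule has_real_derivative_along_line)
  qed
  then obtain t where t: "0 < t" "t < r"
    and "?D (x + s *\<^sub>R v + r *\<^sub>R w) - ?D (x + s *\<^sub>R v) = r * ?H (x + s *\<^sub>R v + t *\<^sub>R w)" by auto
  with s_eq have "G (x + r *\<^sub>R v + r *\<^sub>R w) - G (x + r *\<^sub>R v) - (G (x + r *\<^sub>R w) - G x) =
      r\<^sup>2 * ?H (x + s *\<^sub>R v + t *\<^sub>R w)" by (simp add: power2_eq_square)
  then show ?thesis using that s t by (simp add: algebra_simps)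
qed

text \<open>The second difference over a small parallelogram is \<open>r\<^sup>2\<close> times a
  value of \<open>H v w\<close> and also \<open>r\<^sup>2\<close> times a value of
  \<open>H w v\<close>, both taken near \<open>x\<close>. Continuity of the two at \<open>x\<close>
  brings their values there within any \<open>e\<close>.\<close>

lemma second_derivative_symmetric_real:
  fixes G :: "'a::euclidean_space \<Rightarrow> real"
  assumes W: "open W" "x \<in> W" and G: "Ck_on (Suc (Suc 0)) W G"
  shows "frechet_derivative (\<lambda>z. frechet_derivative G (at z) v) (at x) w =
    frechet_derivative (\<lambda>z. frechet_derivative G (at z) w) (at x) v"
proof -
  define H where "H a b z = frechet_derivative (\<lambda>z. frechet_derivative G (at z) a) (at z) b" for a b z
  have cont: "isCont (H a b) x" for a b
    using G W unfolding H_def by (auto simp: continuous_on_eq_continuous_at)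
  have "\<bar>H v w x - H w v x\<bar> \<le> e" if e: "e > 0" for e
  proof -
    obtain d1 where d1: "d1 > 0" "\<And>z. dist z x < d1 \<Longrightarrow> \<bar>H v w z - H v w x\<bar> < e / 2"
      using cont[of v w] e unfolding continuous_at_eps_delta dist_real_def by (meson half_gt_zero)
    obtain d2 where d2: "d2 > 0" "\<And>z. dist z x < d2 \<Longrightarrow> \<bar>H w v z - H w v x\<bar> < e / 2"
      using cont[of w v] e unfolding continuous_at_eps_delta dist_real_def by (meson half_gt_zero)
    obtain d3 where d3: "d3 > 0" "ball x d3 \<subseteq> W"
      using W openE by blast
    define d where "d = min d1 (min d2 d3)"
    \<comment> \<open>With this \<open>m\<close> and \<open>r\<close> the parallelogram stays within
      \<open>r * m = d / 2\<close> of \<open>x\<close>; the summand 1 keeps \<open>m\<close>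
      positive when \<open>v = w = 0\<close>.\<close>
    define m where "m = norm v + norm w + 1"
    define r where "r = d / (2 * m)"
    have pos: "m > 0" by (simp add: m_def add_nonneg_pos)
    have d: "d > 0" using d1 d2 d3 by (simp add: d_def)
    then have r: "r > 0" using pos by (simp add: r_def)
    have close: "dist (x + s *\<^sub>R v + t *\<^sub>R w) x < d" if "0 \<le> s" "s \<le> r" "0 \<le> t" "t \<le> r" for s t
    proof -
      have "dist (x + s *\<^sub>R v + t *\<^sub>R w) x = norm (s *\<^sub>R v + t *\<^sub>R w)"
        by (simp add: dist_norm)
      also have "\<dots> \<le> s * norm v + t * norm w"
        using that norm_triangle_ineq[of "s *\<^sub>R v" "t *\<^sub>R w"] by simp
      also have "\<dots> \<le> r * norm v + r * norm w"
        using that by (intro add_mono mult_right_mono) auto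
      also have "\<dots> \<le> r * m"
        using r by (simp add: m_def algebra_simps)
      also have "\<dots> = d / 2" using pos by (simp add: r_def)
      finally show ?thesis using d by simp
    qed
    have sub: "x + s *\<^sub>R v + t *\<^sub>R w \<in> W" if "0 \<le> s" "s \<le> r" "0 \<le> t" "t \<le> r" for s t
      using close[OF that] d3 by (auto simp: d_def dist_commute subset_iff)
    obtain s t where st: "0 < s" "s < r" "0 < t" "t < r" "G (x + r *\<^sub>R v + r *\<^sub>R w) - G (x + r *\<^sub>R v) -
        G (x + r *\<^sub>R w) + G x = r\<^sup>2 * H v w (x + s *\<^sub>R v + t *\<^sub>R w)"
      unfolding H_def using second_difference_MVT[OF W(1) G r sub] by blast
    have sub': "x + s *\<^sub>R w + t *\<^sub>R v \<in> W" if "0 \<le> s" "s \<le> r" "0 \<le> t" "t \<le> r" for s t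
      using sub[OF that(3,4,1,2)] by (simp add: algebra_simps)
    obtain s' t' where st': "0 < s'" "s' < r" "0 < t'" "t' < r" "G (x + r *\<^sub>R w + r *\<^sub>R v) - G (x + r *\<^sub>R w) -
        G (x + r *\<^sub>R v) + G x = r\<^sup>2 * H w v (x + s' *\<^sub>R w + t' *\<^sub>R v)"
      unfolding H_def using second_difference_MVT[OF W(1) G r sub'] by blast
    have "r\<^sup>2 * H v w (x + s *\<^sub>R v + t *\<^sub>R w) = r\<^sup>2 * H w v (x + s' *\<^sub>R w + t' *\<^sub>R v)"
      using st(5) st'(5) by (simp add: algebra_simps)
    then have "H v w (x + s *\<^sub>R v + t *\<^sub>R w) = H w v (x + t' *\<^sub>R v + s' *\<^sub>R w)"
      using r by (simp add: algebra_simps)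
    moreover have "\<bar>H v w (x + s *\<^sub>R v + t *\<^sub>R w) - H v w x\<bar> < e / 2"
      using d1(2) close[of s t] st by (simp add: d_def)
    moreover have "\<bar>H w v (x + t' *\<^sub>R v + s' *\<^sub>R w) - H w v x\<bar> < e / 2"
      using d2(2) close[of t' s'] st' by (simp add: d_def)
    ultimately show ?thesis by linarith
  qed
  then have "\<bar>H v w x - H w v x\<bar> \<le> 0" by (rule field_le_epsilon) simp
  then show ?thesis by (simp add: H_def)
qed

lemma second_derivative_symmetric:
  assumes W: "open W" "x \<in> W" and G: "Ck_on (Suc (Suc 0)) W G"
  shows "frechet_derivative (\<lambda>z. frechet_derivative G (at z) v) (at x) w =
    frechet_derivative (\<lambda>z. frechet_derivative G (at z) w) (at x) v"
proof (rule euclidean_eqI)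
  fix b :: 'b assume "b \<in> Basis"
  let ?D = "\<lambda>a z. frechet_derivative G (at z) a"
  have inner: "((\<lambda>z. F z \<bullet> b) has_derivative (\<lambda>h. frechet_derivative F (at z) h \<bullet> b)) (at z)"
    if "Ck_on (Suc k) W F" "z \<in> W" for F k z
    using Ck_on_has_derivative[OF W(1) that] by (rule has_derivative_inner_left)
  have D: "frechet_derivative (\<lambda>z. G z \<bullet> b) (at z) a = ?D a z \<bullet> b" if "z \<in> W" for z a
    using frechet_derivative_at[OF inner[OF G that]] by metis
  have DD: "frechet_derivative (\<lambda>z. frechet_derivative (\<lambda>z. G z \<bullet> b) (at z) a) (at x) c =
      frechet_derivative (?D a) (at x) c \<bullet> b" for a c
  proof -
    have "((\<lambda>z. frechet_derivative (\<lambda>z. G z \<bullet> b) (at z) a) has_derivative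
        (\<lambda>h. frechet_derivative (?D a) (at x) h \<bullet> b)) (at x)"
      by (rule has_derivative_transform_within_open[OF inner[OF Ck_on_derivative[OF G] W(2)] W])
        (simp add: D)
    from frechet_derivative_at[OF this] show ?thesis by metis
  qed
  have "Ck_on (Suc (Suc 0)) W (\<lambda>z. G z \<bullet> b)"
    by (rule Ck_on_linear_compose[OF W(1) bounded_linear.linear[OF bounded_linear_inner_left] G])
  from second_derivative_symmetric_real[OF W this]
  show "frechet_derivative (?D v) (at x) w \<bullet> b = frechet_derivative (?D w) (at x) v \<bullet> b"
    unfolding DD .
qed

subsection \<open>Sections over the sphere\<close>

lemma e_neg_inner: "e_neg \<bullet> (e_neg :: real ^ 'n::finite ix) = 1"
  by (simp add: e_neg_def inner_axis_axis)

lemma S2nD: "p \<in> S2n \<Longrightarrow> p \<bullet> p = 1" "p \<in> S2n \<Longrightarrow> p \<bullet> e_neg = 0" "p \<in> S2n \<Longrightarrow> e_neg \<bullet> p = 0"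
  by (auto simp: S2n_def orthogonal_def norm_eq_1 inner_commute)

lemma TSD: "X \<in> TS p \<Longrightarrow> X \<bullet> e_neg = 0" "X \<in> TS p \<Longrightarrow> X \<bullet> p = 0"
    "X \<in> TS p \<Longrightarrow> e_neg \<bullet> X = 0" "X \<in> TS p \<Longrightarrow> p \<bullet> X = 0"
  by (auto simp: TS_def orthogonal_def inner_commute)

lemma TSI: "X \<bullet> e_neg = 0 \<Longrightarrow> X \<bullet> p = 0 \<Longrightarrow> X \<in> TS p"
  by (auto simp: TS_def orthogonal_def)

lemma subspace_TS: "subspace (TS p)"
  by (auto simp: subspace_def TS_def orthogonal_clauses)

text \<open>For \<open>p\<close> in \<open>S2n\<close> the vectors \<open>e_neg\<close> and
  \<open>p\<close> are orthonormal, and this is the orthogonal projection onto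
  \<open>TS p\<close>.\<close>

definition proj_TS :: "real ^ 'n::finite ix \<Rightarrow> real ^ 'n ix \<Rightarrow> real ^ 'n ix" where
  "proj_TS p v = v - (v \<bullet> e_neg) *\<^sub>R e_neg - (v \<bullet> p) *\<^sub>R p"

lemma proj_TS_in: "p \<in> S2n \<Longrightarrow> proj_TS p v \<in> TS p"
  by (rule TSI) (auto simp: proj_TS_def inner_diff_left S2nD e_neg_inner)

lemma TS_decompose: "v = (v \<bullet> e_neg) *\<^sub>R e_neg + (v \<bullet> p) *\<^sub>R p + proj_TS p v"
  by (simp add: proj_TS_def)

lemma linear_proj_TS: "linear (proj_TS p)"
  by (rule linearI) (auto simp: proj_TS_def inner_add_left algebra_simps)

lemma proj_TS_id: "X \<in> TS p \<Longrightarrow> proj_TS p X = X"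
  by (simp add: proj_TS_def TSD)

lemma uminus_matrix_vector_mult: "(- A) *v v = - (A *v (v :: real ^ 'm::finite))"
  by (simp add: matrix_vector_mult_def vec_eq_iff sum_negf)

lemma matrix_vector_mult_uminus: "A *v (- v) = - (A *v (v :: real ^ 'm::finite))"
  by (simp add: linear_neg)

lemma inner_matrix_vector_mult: "(A *v u) \<bullet> v = u \<bullet> (transpose A *v (v :: real ^ 'm::finite))"
  by (metis dot_lmul_matrix transpose_matrix_vector transpose_transpose)

text \<open>\<open>A\<close> preserves the splitting of the space into the plane of
  \<open>e_neg\<close> and \<open>p\<close> and its complement \<open>TS p\<close>, and acts on the
  plane as the quarter turn \<open>e_neg\<close> to \<open>p\<close> to \<open>- e_neg\<close>. This
  fixes two components of every \<open>A *v v\<close>.\<close>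

lemma JS_mult:
  assumes "A \<in> JS" "proj_J A = p"
  shows "p \<in> S2n" "A *v e_neg = p" "A *v p = - e_neg" "A *v (A *v v) = - v"
    and "X \<in> TS p \<Longrightarrow> A *v X \<in> TS p"
    and "(A *v v) \<bullet> e_neg = - (v \<bullet> p)" "(A *v v) \<bullet> p = v \<bullet> e_neg"
proof -
  show p: "p \<in> S2n" and e: "A *v e_neg = p"
    using assms by (auto simp: JS_def proj_J_def)
  have sq: "A *v (A *v v) = - v" for v
    using assms by (simp add: JS_def JR_def matrix_vector_mul_assoc uminus_matrix_vector_mult)
  then show "A *v (A *v v) = - v" .
  show Ap: "A *v p = - e_neg" using sq e by metis
  have T: "A *v X \<in> TS p" if "X \<in> TS p" for X
    using that assms by (auto simp: JS_def TS_def)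
  then show "X \<in> TS p \<Longrightarrow> A *v X \<in> TS p" .
  have "A *v v = (v \<bullet> e_neg) *\<^sub>R p - (v \<bullet> p) *\<^sub>R e_neg + A *v proj_TS p v"
    by (subst TS_decompose[of v p]) (simp add: matrix_vector_right_distrib matrix_vector_mult_scaleR e Ap)
  then show "(A *v v) \<bullet> e_neg = - (v \<bullet> p)" "(A *v v) \<bullet> p = v \<bullet> e_neg"
    using TSD[OF T[OF proj_TS_in[OF p]]] by (auto simp: inner_add_left inner_diff_left S2nD[OF p] e_neg_inner)
qed

text \<open>On the plane of \<open>e_neg\<close> and \<open>p\<close> the matrix is a quarter turn,
  which is skew, and it preserves the orthogonal splitting; so skewness is decided on
  \<open>TS p\<close>.\<close>

lemma JS_skew_iff:
  assumes A: "A \<in> JS" "proj_J A = p"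
  shows "A \<in> JS_tilde \<longleftrightarrow> (\<forall>X\<in>TS p. \<forall>Y\<in>TS p. (A *v X) \<bullet> Y = - (X \<bullet> (A *v Y)))"
proof -
  note J = JS_mult[OF A]
  have "A \<in> JS_tilde \<longleftrightarrow> transpose A = - A"
    using A(1) by (simp add: JS_tilde_def)
  also have "\<dots> \<longleftrightarrow> (\<forall>u v. (A *v u) \<bullet> v = - (u \<bullet> (A *v v)))"
  proof (intro iffI allI)
    show "(A *v u) \<bullet> v = - (u \<bullet> (A *v v))" if "transpose A = - A" for u v
      unfolding inner_matrix_vector_mult that uminus_matrix_vector_mult by simp
    assume *: "\<forall>u v. (A *v u) \<bullet> v = - (u \<bullet> (A *v v))"
    have *: "u \<bullet> (transpose A *v v) = u \<bullet> (- A *v v)" for u v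
      using *[rule_format, of u v]
      by (simp only: inner_matrix_vector_mult[of A u v] uminus_matrix_vector_mult inner_minus_right)
    have "transpose A *v v = - A *v v" for v
      by (rule iffD1[OF vector_eq_ldot], rule allI, rule *)
    then show "transpose A = - A"
      unfolding matrix_eq by blast
  qed
  also have "\<dots> \<longleftrightarrow> (\<forall>X\<in>TS p. \<forall>Y\<in>TS p. (A *v X) \<bullet> Y = - (X \<bullet> (A *v Y)))"
  proof (intro iffI allI ballI)
    fix u v assume sk: "\<forall>X\<in>TS p. \<forall>Y\<in>TS p. (A *v X) \<bullet> Y = - (X \<bullet> (A *v Y))"
    let ?u = "proj_TS p u" and ?v = "proj_TS p v"
    have uv: "?u \<in> TS p" "?v \<in> TS p" "A *v ?u \<in> TS p" "A *v ?v \<in> TS p"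
      using J(5) proj_TS_in[OF J(1)] by blast+
    have dec: "A *v w = (w \<bullet> e_neg) *\<^sub>R p - (w \<bullet> p) *\<^sub>R e_neg + A *v proj_TS p w" for w
      by (subst TS_decompose[of w p]) (simp add: matrix_vector_right_distrib matrix_vector_mult_scaleR J)
    have "(A *v u) \<bullet> v = (A *v u) \<bullet> ((v \<bullet> e_neg) *\<^sub>R e_neg + (v \<bullet> p) *\<^sub>R p + ?v)"
      by (simp only: TS_decompose[symmetric])
    also have "\<dots> = - (v \<bullet> e_neg) * (u \<bullet> p) + (v \<bullet> p) * (u \<bullet> e_neg) + (A *v u) \<bullet> ?v"
      by (simp add: inner_add_right J)
    also have "(A *v u) \<bullet> ?v = (A *v ?u) \<bullet> ?v"
      by (subst dec) (simp add: inner_add_left inner_diff_left TSD[OF uv(2)])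
    also have "\<dots> = - (?u \<bullet> (A *v ?v))" using sk uv by blast
    also have "?u \<bullet> (A *v ?v) = ?u \<bullet> (A *v v)"
      by (subst (2) dec) (simp add: inner_add_right inner_diff_right TSD[OF uv(1)])
    finally have 1: "(A *v u) \<bullet> v =
      - (v \<bullet> e_neg) * (u \<bullet> p) + (v \<bullet> p) * (u \<bullet> e_neg) - ?u \<bullet> (A *v v)" by simp
    have "u \<bullet> (A *v v) = ((u \<bullet> e_neg) *\<^sub>R e_neg + (u \<bullet> p) *\<^sub>R p + ?u) \<bullet> (A *v v)"
      by (simp only: TS_decompose[symmetric])
    also have "\<dots> = - (u \<bullet> e_neg) * (v \<bullet> p) + (u \<bullet> p) * (v \<bullet> e_neg) + ?u \<bullet> (A *v v)"
      using J(6,7)[of v] by (simp add: inner_add_left inner_commute[of e_neg "A *v v"] inner_commute[of p "A *v v"])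
    finally show "(A *v u) \<bullet> v = - (u \<bullet> (A *v v))" using 1 by (simp add: mult.commute)
  qed blast
  finally show ?thesis .
qed

text \<open>The device for differentiating identities that hold on \<open>U\<close>: derivatives
  within \<open>U\<close> are determined on tangent vectors only, so both sides are compared
  there.\<close>

lemma differential_unique:
  fixes f g :: "real ^ 'n::finite ix \<Rightarrow> 'b::euclidean_space"
  assumes U: "openin (top_of_set S2n) U" "p \<in> U" and X: "X \<in> TS p"
    and D: "(f has_derivative D) (at p within U)" "(g has_derivative E) (at p within U)"
    and eq: "\<And>q. q \<in> U \<Longrightarrow> f q = g q"
  shows "D X = E X"
proof -
  have "(f has_derivative E) (at p within U)"
    using has_derivative_transform[OF U(2) eq D(2)] .
  from differential_eqI[OF U X D(1)] differential_eqI[OF U X this] show ?thesis by simp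
qed

lemma bounded_bilinear_matrix_vector_mult:
  "bounded_bilinear ((*v) :: real ^ 'n::finite ^ 'm::finite \<Rightarrow> _)"
proof -
  have "linear (\<lambda>A :: real ^ 'n ^ 'm. A *v v)" for v
    by (rule linearI) (simp_all add: matrix_vector_mult_add_rdistrib scaleR_matrix_vector_assoc)
  then show ?thesis
    by (simp add: bilinear_def flip: bilinear_conv_bounded_bilinear)
qed

lemmas has_derivative_matrix_vector_mult =
  bounded_bilinear.FDERIV[OF bounded_bilinear_matrix_vector_mult]

section \<open>Derivative identities for a section\<close>

locale acs_section =
  fixes U :: "(real ^ 'n::finite ix) set" and f :: "real ^ 'n ix \<Rightarrow> real ^ 'n ix ^ 'n ix"
  assumes openU: "openin (top_of_set S2n) U" and sec: "local_section JS U f"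
begin

abbreviation df where "df \<equiv> differential U f"

lemma f_JS: "p \<in> U \<Longrightarrow> f p \<in> JS" "p \<in> U \<Longrightarrow> proj_J (f p) = p"
  using sec by (auto simp: local_section_def)

lemmas f_mult = JS_mult[OF f_JS]

lemma df_has_derivative: "p \<in> U \<Longrightarrow> (f has_derivative df p) (at p within U)"
  using sec smooth_on_has_derivative by (auto simp: local_section_def)

lemma df_mult_const:
  assumes "p \<in> U" shows "((\<lambda>q. f q *v v) has_derivative (\<lambda>X. df p X *v v)) (at p within U)"
  using has_derivative_matrix_vector_mult[OF df_has_derivative[OF assms] has_derivative_const[of v]] by simp

lemma df_e_neg:
  assumes "p \<in> U" "X \<in> TS p" shows "df p X *v e_neg = X"
  using differential_unique[OF openU assms df_mult_const[OF assms(1)] has_derivative_ident] f_mult(2)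
  by blast

lemma df_inner_e_neg:
  assumes "p \<in> U" "X \<in> TS p" shows "(df p X *v v) \<bullet> e_neg = - (v \<bullet> X)"
proof (rule differential_unique[OF openU assms])
  show "((\<lambda>q. (f q *v v) \<bullet> e_neg) has_derivative (\<lambda>X. (df p X *v v) \<bullet> e_neg)) (at p within U)"
    by (rule has_derivative_inner_left[OF df_mult_const[OF assms(1)]])
  show "((\<lambda>q. - (v \<bullet> q)) has_derivative (\<lambda>X. - (v \<bullet> X))) (at p within U)"
    by (auto intro!: derivative_eq_intros)
qed (rule f_mult(6))

text \<open>Product rule for \<open>(f q *v v) \<bullet> q\<close>, which has the constant value
  \<open>v \<bullet> e_neg\<close>.\<close>

lemma df_inner_base:
  assumes "p \<in> U" "X \<in> TS p" shows "(df p X *v v) \<bullet> p = - ((f p *v v) \<bullet> X)"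
proof -
  have "(f p *v v) \<bullet> X + (df p X *v v) \<bullet> p = 0"
  proof (rule differential_unique[OF openU assms])
    show "((\<lambda>q. (f q *v v) \<bullet> q) has_derivative (\<lambda>X. (f p *v v) \<bullet> X + (df p X *v v) \<bullet> p)) (at p within U)"
      by (rule has_derivative_inner[OF df_mult_const[OF assms(1)] has_derivative_ident])
  qed (auto simp: f_mult(7))
  then show ?thesis by simp
qed

text \<open>Derivative of the identity \<open>f q *v (f q *v v) = - v\<close>: the values of
  \<open>df p\<close> are tangent to \<open>JR\<close> at \<open>f p\<close>.\<close>

lemma df_anticommute:
  assumes "p \<in> U" "X \<in> TS p" shows "df p X *v (f p *v v) = - (f p *v (df p X *v v))"
proof -
  have "f p *v (df p X *v v) + df p X *v (f p *v v) = 0"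
  proof (rule differential_unique[OF openU assms])
    show "((\<lambda>q. f q *v (f q *v v)) has_derivative
        (\<lambda>X. f p *v (df p X *v v) + df p X *v (f p *v v))) (at p within U)"
      by (rule has_derivative_matrix_vector_mult[OF df_has_derivative[OF assms(1)] df_mult_const[OF assms(1)]])
  qed (auto simp: f_mult(4))
  then show ?thesis by (simp add: eq_neg_iff_add_eq_0 add.commute)
qed

lemma holomorphicD:
  assumes "holomorphic_section U f" "p \<in> U" "X \<in> TS p"
  shows "df p (f p *v X) *v v = f p *v (df p X *v v)"
proof -
  have "df p (f p *v X) = f p ** df p X"
    using assms by (simp add: J_of_def JR_tilde_def holomorphic_section_def)
  then show ?thesis by (simp add: matrix_vector_mul_assoc)
qed

section \<open>Skewness, orthogonality and holomorphy\<close>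

lemma local_section_JS_tilde_iff:
  "local_section JS_tilde U f \<longleftrightarrow>
    (\<forall>p\<in>U. \<forall>X\<in>TS p. \<forall>Y\<in>TS p. (f p *v X) \<bullet> Y = - (X \<bullet> (f p *v Y)))"
  using sec JS_skew_iff[OF f_JS] by (auto simp: local_section_def)

text \<open>As the square of \<open>f p\<close> is -1, replacing \<open>Y\<close> by
  \<open>f p *v Y\<close> turns the isometry identity into skewness, and conversely.\<close>

lemma orthogonal_acs_iff:
  "orthogonal_acs U (J_of f) \<longleftrightarrow> local_section JS_tilde U f"
  unfolding local_section_JS_tilde_iff orthogonal_acs_def J_of_def
proof (rule ball_cong[OF refl], intro iffI ballI)
  fix p X Y assume p: "p \<in> U" and X: "X \<in> TS p" and Y: "Y \<in> TS p"
  {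
    assume "\<forall>X\<in>TS p. \<forall>Y\<in>TS p. (f p *v X) \<bullet> (f p *v Y) = X \<bullet> Y"
    then have "(f p *v X) \<bullet> (f p *v (f p *v Y)) = X \<bullet> (f p *v Y)"
      using X f_mult(5)[OF p p Y] by blast
    then show "(f p *v X) \<bullet> Y = - (X \<bullet> (f p *v Y))"
      by (simp add: f_mult(4)[OF p p])
  next
    assume "\<forall>X\<in>TS p. \<forall>Y\<in>TS p. (f p *v X) \<bullet> Y = - (X \<bullet> (f p *v Y))"
    then have "(f p *v X) \<bullet> (f p *v Y) = - (X \<bullet> (f p *v (f p *v Y)))"
      using X f_mult(5)[OF p p Y] by blast
    then show "(f p *v X) \<bullet> (f p *v Y) = X \<bullet> Y"
      by (simp add: f_mult(4)[OF p p])
  }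
qed

text \<open>With \<open>A = f p\<close>, the \<open>e_neg\<close>-component of
  \<open>df p (A *v X) *v Y\<close> is \<open>- (Y \<bullet> (A *v X))\<close>. That of
  \<open>A *v (df p X *v Y)\<close> is minus the \<open>p\<close>-component of
  \<open>df p X *v Y\<close>, namely \<open>(A *v Y) \<bullet> X\<close>. Holomorphy equates the
  two.\<close>

lemma holomorphic_imp_JS_tilde:
  assumes "holomorphic_section U f" shows "local_section JS_tilde U f"
  unfolding local_section_JS_tilde_iff
proof (intro ballI)
  fix p X Y assume *: "p \<in> U" "X \<in> TS p" "Y \<in> TS p"
  have "- (Y \<bullet> (f p *v X)) = (df p (f p *v X) *v Y) \<bullet> e_neg"
    using df_inner_e_neg[OF *(1) f_mult(5)[OF *(1,1,2)]] by simp
  also have "\<dots> = - ((df p X *v Y) \<bullet> p)"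
    using holomorphicD[OF assms *(1,2)] f_mult(6)[OF *(1,1)] by simp
  also have "\<dots> = (f p *v Y) \<bullet> X"
    using df_inner_base[OF *(1,2)] by simp
  finally show "(f p *v X) \<bullet> Y = - (X \<bullet> (f p *v Y))" by (simp add: inner_commute)
qed

text \<open>The hypothesis \<open>sym\<close> says that the defect of holomorphy is symmetric in two
  tangent vectors; integrability will supply it. Skewness of the section then forces the defect to
  vanish.\<close>

lemma holomorphicI:
  assumes sk: "local_section JS_tilde U f"
    and sym: "\<And>p X Y. p \<in> U \<Longrightarrow> X \<in> TS p \<Longrightarrow> Y \<in> TS p \<Longrightarrow>
      df p (f p *v X) *v Y - f p *v (df p X *v Y) = df p (f p *v Y) *v X - f p *v (df p Y *v X)"
  shows "holomorphic_section U f"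
  unfolding holomorphic_section_def
proof (intro ballI)
  fix p X assume p: "p \<in> U" and X: "X \<in> TS p"
  note J = f_mult[OF p p]
  have skew: "(f q *v u) \<bullet> v = - (u \<bullet> (f q *v v))" if "q \<in> U" for q u v
  proof -
    have "transpose (f q) = - f q" using sk that by (auto simp: local_section_def JS_tilde_def)
    then show ?thesis
      by (simp add: inner_matrix_vector_mult uminus_matrix_vector_mult)
  qed
  have dskew: "(df p Z *v u) \<bullet> v = - (u \<bullet> (df p Z *v v))" if "Z \<in> TS p" for Z u v
  proof (rule differential_unique[OF openU p that])
    show "((\<lambda>q. (f q *v u) \<bullet> v) has_derivative (\<lambda>Z. (df p Z *v u) \<bullet> v)) (at p within U)"
      by (rule has_derivative_inner_left[OF df_mult_const[OF p]])
    show "((\<lambda>q. - (u \<bullet> (f q *v v))) has_derivative (\<lambda>Z. - (u \<bullet> (df p Z *v v)))) (at p within U)"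
      by (rule has_derivative_minus[OF has_derivative_inner_right[OF df_mult_const[OF p]]])
  qed (rule skew)
  define N where "N Z v = df p (f p *v Z) *v v - f p *v (df p Z *v v)" for Z v
  have N_sym: "N Z Y = N Y Z" if "Z \<in> TS p" "Y \<in> TS p" for Z Y
    unfolding N_def using sym[OF p that] .
  \<comment> \<open>The product of \<open>f p\<close> and \<open>df p Z\<close> is skew because both
    factors are skew and they anticommute.\<close>
  have N_skew: "N Z u \<bullet> v = - (N Z v \<bullet> u)" if "Z \<in> TS p" for Z u v
  proof -
    have "(f p *v (df p Z *v u)) \<bullet> v = u \<bullet> (df p Z *v (f p *v v))"
      by (simp add: skew[OF p] dskew[OF that])
    also have "\<dots> = - (u \<bullet> (f p *v (df p Z *v v)))"
      by (simp add: df_anticommute[OF p that])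
    finally show ?thesis
      using dskew[OF J(5)[OF that], of u v] by (simp add: N_def inner_diff_left inner_diff_right inner_commute)
  qed
  have N_e: "N Z e_neg = 0" if "Z \<in> TS p" for Z
    by (simp add: N_def df_e_neg[OF p] that J(5))
  \<comment> \<open>Since \<open>p\<close> is the image of \<open>e_neg\<close> under
    \<open>f p\<close>, anticommutation carries the known values at \<open>e_neg\<close> over to
    \<open>p\<close>.\<close>
  have N_p: "N Z p = 0" if "Z \<in> TS p" for Z
  proof -
    have "df p W *v p = - (f p *v W)" if "W \<in> TS p" for W
      using df_anticommute[OF p that, of e_neg] by (simp add: J(2) df_e_neg[OF p that])
    then show ?thesis
      by (simp add: N_def that J(4,5) matrix_vector_mult_uminus)
  qed
  have N_TS: "N Z v \<in> TS p" if "Z \<in> TS p" for Z v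
    by (rule TSI) (simp_all add: N_skew[OF that, of v] N_e[OF that] N_p[OF that])
  \<comment> \<open>A trilinear form that is symmetric in its first and skew in its last two arguments vanishes.\<close>
  have N_TS0: "N X Y \<bullet> Z = 0" if "Y \<in> TS p" "Z \<in> TS p" for Y Z
    using N_skew[OF X, of Y Z] N_skew[OF that(1), of Z X] N_skew[OF that(2), of X Y]
      N_sym[OF X that(1)] N_sym[OF X that(2)] N_sym[OF that] by simp
  have N_lin: "N X (a *\<^sub>R e_neg + b *\<^sub>R p + Y) = N X Y" for a b Y
  proof -
    have "N X (a *\<^sub>R e_neg + b *\<^sub>R p + Y) = a *\<^sub>R N X e_neg + b *\<^sub>R N X p + N X Y"
      by (simp add: N_def matrix_vector_right_distrib matrix_vector_mult_scaleR algebra_simps)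
    then show ?thesis by (simp add: N_e[OF X] N_p[OF X])
  qed
  \<comment> \<open>\<open>N X v\<close> depends only on the tangential part of \<open>v\<close>;
    pairing it with the tangent vector \<open>N X v\<close> itself shows that its norm is
    zero.\<close>
  have "N X v = 0" for v
  proof -
    have "N X v = N X (proj_TS p v)"
      using N_lin TS_decompose[of v p] by metis
    then show ?thesis
      using N_TS0[OF proj_TS_in[OF J(1)] N_TS[OF X], of v v] by simp
  qed
  then show "JR_tilde (f p) (df p X) = df p (J_of f p X)"
    unfolding JR_tilde_def J_of_def matrix_eq N_def by (simp add: matrix_vector_mul_assoc)
qed

end

subsection \<open>Integrable structures\<close>

lemma has_derivative_constant_eq_0:
  assumes "(g has_derivative D) (at z)" "open W" "z \<in> W" "\<And>y. y \<in> W \<Longrightarrow> g y = c"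
  shows "D v = 0"
proof -
  have "(g has_derivative (\<lambda>v. 0)) (at z)"
    by (rule has_derivative_transform_within_open[OF has_derivative_const[of c] assms(2,3)])
      (simp add: assms(4))
  from has_derivative_unique[OF assms(1) this] show ?thesis by simp
qed

context acs_section
begin

text \<open>The inverse chart \<open>\<psi>\<close> satisfies the Cauchy-Riemann equation
  \<open>E_J\<close>. Its derivative expresses \<open>df p (E z u) *v E z v\<close> through second
  derivatives \<open>S\<close> of \<open>\<psi>\<close>, and the defect becomes an expression in
  \<open>S\<close> whose symmetry is that of second derivatives.\<close>

lemma integrable_imp_symmetric:
  assumes int: "integrable_acs U (J_of f)" and p: "p \<in> U" and X: "X \<in> TS p" and Y: "Y \<in> TS p"
  shows "df p (f p *v X) *v Y - f p *v (df p X *v Y) = df p (f p *v Y) *v X - f p *v (df p Y *v X)"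
proof -
  have "\<exists>V (W :: (complex ^ 'n) set) \<phi> \<psi>.
      openin (top_of_set U) V \<and> p \<in> V \<and> open W \<and>
      homeomorphism V W \<phi> \<psi> \<and> smooth_on V \<phi> \<and> smooth_on W \<psi> \<and>
      (\<forall>q\<in>V. \<forall>X\<in>TS q. differential V \<phi> q (f q *v X) = \<i> *s differential V \<phi> q X)"
    using bspec[OF int[unfolded integrable_acs_def J_of_def] p] .
  then obtain V and W :: "(complex ^ 'n) set" and \<phi> \<psi> where
    V: "openin (top_of_set U) V" "p \<in> V" and W: "open W" and hom: "homeomorphism V W \<phi> \<psi>"
    and smooth: "smooth_on V \<phi>" "smooth_on W \<psi>"
    and J': "\<forall>q\<in>V. \<forall>X\<in>TS q. differential V \<phi> q (f q *v X) = \<i> *s differential V \<phi> q X"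
    by (elim exE conjE)
  have J: "differential V \<phi> q (f q *v X) = \<i> *s differential V \<phi> q X" if "q \<in> V" "X \<in> TS q" for q X
    using J' that by blast
  have VS: "openin (top_of_set S2n) V" using V(1) openU openin_trans by blast
  have VU: "V \<subseteq> U" using V(1) openin_imp_subset by blast
  have \<phi>\<psi>: "\<phi> (\<psi> z) = z" "\<psi> z \<in> V" if "z \<in> W" for z
    using hom that unfolding homeomorphism_def by auto
  have \<psi>\<phi>: "\<psi> (\<phi> q) = q" "\<phi> q \<in> W" if "q \<in> V" for q
    using hom that unfolding homeomorphism_def by auto
  \<comment> \<open>\<open>smooth_on\<close> yields only a local extension near
    \<open>\<phi> p\<close>; shrinking to \<open>W'\<close> makes \<open>\<psi>\<close> itself C^k
    on one open set for all \<open>k\<close>.\<close>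
  obtain O1 \<Psi> where O1: "open O1" "\<phi> p \<in> O1" and \<Psi>: "\<And>k. Ck_on k O1 \<Psi>"
    and \<Psi>_eq: "\<And>y. y \<in> W \<inter> O1 \<Longrightarrow> \<Psi> y = \<psi> y"
    using bspec[OF smooth(2)[unfolded smooth_on_def] \<psi>\<phi>(2)[OF V(2)]] by metis
  define W' where "W' = W \<inter> O1"
  have W': "open W'" "\<phi> p \<in> W'" "W' \<subseteq> W"
    using W O1 \<psi>\<phi>(2)[OF V(2)] by (auto simp: W'_def)
  have Ck: "Ck_on k W' \<psi>" for k
    by (rule Ck_on_cong[OF W'(1) _ Ck_on_subset[OF O1(1) W'(1) _ \<Psi>]])
      (use \<Psi>_eq in \<open>auto simp: W'_def\<close>)
  define E where "E z = frechet_derivative \<psi> (at z)" for z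
  have hE: "(\<psi> has_derivative E z) (at z)" if "z \<in> W'" for z
    unfolding E_def using Ck_on_has_derivative[OF W'(1) Ck that] .
  have \<psi>S: "\<psi> z \<in> S2n" if "z \<in> W'" for z
    using \<phi>\<psi>(2) W'(3) VS that openin_imp_subset by blast
  have E_TS: "E z v \<in> TS (\<psi> z)" if "z \<in> W'" for z v
  proof (rule TSI)
    show "E z v \<bullet> e_neg = 0"
      by (rule has_derivative_constant_eq_0[OF has_derivative_inner_left[OF hE[OF that]] W'(1) that])
        (simp add: S2nD \<psi>S)
    have "\<psi> z \<bullet> E z v + E z v \<bullet> \<psi> z = 0"
      by (rule has_derivative_constant_eq_0[OF has_derivative_inner[OF hE[OF that] hE[OF that]] W'(1) that])
        (simp add: S2nD \<psi>S)
    then show "E z v \<bullet> \<psi> z = 0" by (simp add: inner_commute)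
  qed
  \<comment> \<open>\<open>E\<close> and the differential of \<open>\<phi>\<close> are mutually
    inverse. This transfers complex linearity from \<open>\<phi>\<close> to \<open>\<psi>\<close>
    and writes each tangent vector at \<open>p\<close> as some \<open>E z u\<close>.\<close>
  have E_d\<phi>: "E (\<phi> q) (differential V \<phi> q T) = T" if "q \<in> V" "\<phi> q \<in> W'" "T \<in> TS q" for q T
  proof (rule differential_unique[OF VS that(1,3)])
    show "((\<lambda>q. \<psi> (\<phi> q)) has_derivative (\<lambda>T. E (\<phi> q) (differential V \<phi> q T))) (at q within V)"
      by (rule has_derivative_compose[OF smooth_on_has_derivative[OF smooth(1) that(1)] hE[OF that(2)]])
    show "((\<lambda>q. q) has_derivative (\<lambda>T. T)) (at q within V)" by (rule has_derivative_ident)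
  qed (rule \<psi>\<phi>(1))
  have d\<phi>_E: "differential V \<phi> (\<psi> z) (E z v) = v" if "z \<in> W'" for z v
  proof -
    have "(\<phi> has_derivative differential V \<phi> (\<psi> z)) (at (\<psi> z) within \<psi> ` W')"
      by (rule has_derivative_subset[OF smooth_on_has_derivative[OF smooth(1)]])
        (use \<phi>\<psi> W'(3) that in auto)
    from has_derivative_in_compose[OF has_derivative_at_withinI[OF hE[OF that]] this]
    have "((\<lambda>z. \<phi> (\<psi> z)) has_derivative (\<lambda>v. differential V \<phi> (\<psi> z) (E z v))) (at z)"
      by (simp only: at_within_open[OF that W'(1)])
    moreover have "((\<lambda>z. \<phi> (\<psi> z)) has_derivative (\<lambda>v. v)) (at z)"
      by (rule has_derivative_transform_within_open[OF has_derivative_ident W'(1) that])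
        (use \<phi>\<psi>(1) W'(3) in auto)
    ultimately have "(\<lambda>v. differential V \<phi> (\<psi> z) (E z v)) = (\<lambda>v. v)"
      by (rule has_derivative_unique)
    then show ?thesis by meson
  qed
  have E_J: "E z (\<i> *s v) = f (\<psi> z) *v E z v" if "z \<in> W'" for z v
  proof -
    have q: "\<psi> z \<in> V" "\<phi> (\<psi> z) = z" using \<phi>\<psi> W'(3) that by auto
    have T: "f (\<psi> z) *v E z v \<in> TS (\<psi> z)"
      using f_mult(5) q(1) VU E_TS[OF that] by blast
    have "\<i> *s v = differential V \<phi> (\<psi> z) (f (\<psi> z) *v E z v)"
      using J[OF q(1) E_TS[OF that]] by (simp add: d\<phi>_E[OF that])
    then show ?thesis
      using E_d\<phi>[OF q(1) _ T] q(2) that by simp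
  qed
  define z where "z = \<phi> p"
  have z: "z \<in> W'" "\<psi> z = p" using W'(2) \<psi>\<phi>(1)[OF V(2)] by (auto simp: z_def)
  define S where "S a = frechet_derivative (\<lambda>z. E z a) (at z)" for a
  have hS: "((\<lambda>z. E z a) has_derivative S a) (at z)" for a
    unfolding S_def E_def
    by (rule Ck_on_has_derivative[OF W'(1) Ck_on_derivative[OF Ck[of "Suc (Suc 0)"]] z(1)])
  have S_sym: "S a b = S b a" for a b
    unfolding S_def E_def by (rule second_derivative_symmetric[OF W'(1) z(1) Ck])
  have S_J: "S (\<i> *s v) u = f p *v S v u + df p (E z u) *v E z v" for u v
  proof -
    have "(f has_derivative df p) (at (\<psi> z) within \<psi> ` W')"
      unfolding z(2)
      by (rule has_derivative_subset[OF df_has_derivative[OF p]]) (use \<phi>\<psi>(2) W'(3) VU in auto)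
    from has_derivative_in_compose[OF has_derivative_at_withinI[OF hE[OF z(1)]] this]
    have "((\<lambda>z. f (\<psi> z)) has_derivative (\<lambda>u. df p (E z u))) (at z)"
      by (simp only: at_within_open[OF z(1) W'(1)])
    from has_derivative_matrix_vector_mult[OF this hS[of v]]
    have 1: "((\<lambda>z. f (\<psi> z) *v E z v) has_derivative (\<lambda>u. f p *v S v u + df p (E z u) *v E z v)) (at z)"
      by (simp add: z(2))
    have "((\<lambda>z. E z (\<i> *s v)) has_derivative (\<lambda>u. f p *v S v u + df p (E z u) *v E z v)) (at z)"
      by (rule has_derivative_transform_within_open[OF 1 W'(1) z(1)]) (simp add: E_J)
    from has_derivative_unique[OF hS this] show ?thesis by meson
  qed
  \<comment> \<open>By \<open>E_J\<close>, \<open>f p *v E z u\<close> is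
    \<open>E z (\<i> *s u)\<close>, so \<open>S_J\<close> applies to both terms, in the directions
    \<open>\<i> *s u\<close> and \<open>u\<close>.\<close>
  have N: "df p (f p *v E z u) *v E z v - f p *v (df p (E z u) *v E z v) =
      S (\<i> *s v) (\<i> *s u) - f p *v (S v (\<i> *s u) + S (\<i> *s v) u) - S v u" for u v
  proof -
    have 1: "df p (f p *v E z u) *v E z v = S (\<i> *s v) (\<i> *s u) - f p *v S v (\<i> *s u)"
      using S_J[of v "\<i> *s u"] E_J[OF z(1), of u] by (simp add: z(2))
    have 2: "df p (E z u) *v E z v = S (\<i> *s v) u - f p *v S v u"
      using S_J[of v u] by simp
    show ?thesis unfolding 1 2
      by (simp add: matrix_vector_mult_diff_distrib matrix_vector_right_distrib f_mult(4)[OF p p])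
  qed
  obtain u v where uv: "X = E z u" "Y = E z v"
    using E_d\<phi>[OF V(2) _ X] E_d\<phi>[OF V(2) _ Y] z(1) unfolding z_def by metis
  show ?thesis
    unfolding uv N S_sym[of "\<i> *s v" "\<i> *s u"] S_sym[of v "\<i> *s u"] S_sym[of "\<i> *s v" u] S_sym[of v u]
    by (simp add: add.commute)
qed

end

subsection \<open>Holomorphic coordinates from holomorphic sections\<close>

lemma dim_TS:
  assumes p: "p \<in> S2n"
  shows "dim (TS (p :: real ^ 'n::finite ix)) = 2 * CARD('n)"
proof -
  let ?A = "span {e_neg, p}"
  have ne: "(e_neg :: real ^ 'n ix) \<noteq> 0" "p \<noteq> 0" "p \<noteq> e_neg"
    using S2nD[OF p] e_neg_inner[where 'n='n] by auto
  have "pairwise orthogonal {e_neg, p}"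
    using S2nD[OF p] by (auto simp: pairwise_def orthogonal_def)
  then have "independent {e_neg, p}"
    by (rule pairwise_orthogonal_independent) (use ne in auto)
  then have dim_A: "dim ?A = 2"
    using ne(3) dim_eq_card_independent by fastforce
  have "TS p = {y \<in> UNIV. \<forall>x\<in>?A. orthogonal x y}"
  proof safe
    fix y x assume y: "y \<in> TS p" and "x \<in> ?A"
    from this(2) have "orthogonal y x"
      by (rule orthogonal_to_span) (use y in \<open>auto simp: TS_def\<close>)
    then show "orthogonal x y" by (simp add: orthogonal_commute)
  next
    fix y assume "\<forall>x\<in>?A. orthogonal x y"
    then show "y \<in> TS p"
      by (auto simp: TS_def orthogonal_commute span_base)
  qed auto
  then have "dim (TS p) + dim ?A = dim (UNIV :: (real ^ 'n ix) set)"
    using dim_subspace_orthogonal_to_vectors[of ?A UNIV] by simp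
  moreover have "dim (UNIV :: (real ^ 'n ix) set) = 2 * CARD('n) + 2"
    using card_ix[where 'n='n] by simp
  ultimately show ?thesis using dim_A by simp
qed

text \<open>A complex basis is chosen greedily. The real span \<open>S\<close> built so far is
  invariant under \<open>A\<close>, and any \<open>v\<close> in \<open>T\<close> outside it adds two
  dimensions, through \<open>v\<close> and \<open>A *v v\<close>.\<close>

lemma complex_structure_basis:
  fixes A :: "real ^ 'm::finite ^ 'm" and F :: "'i set"
  assumes T: "subspace T" "\<And>v. v \<in> T \<Longrightarrow> A *v v \<in> T" and sq: "\<And>v. A *v (A *v v) = - v"
    and F: "finite F" "2 * card F \<le> dim T"
  shows "\<exists>g. g ` F \<subseteq> T \<and> dim (g ` F \<union> (\<lambda>i. A *v g i) ` F) = 2 * card F"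
  using F
proof (induction F)
  case empty
  then show ?case by simp
next
  case (insert i F)
  then obtain g where g: "g ` F \<subseteq> T" "dim (g ` F \<union> (\<lambda>i. A *v g i) ` F) = 2 * card F"
    by auto
  define S where "S = g ` F \<union> (\<lambda>i. A *v g i) ` F"
  have "S \<subseteq> T" using g T(2) by (auto simp: S_def)
  then have ST: "span S \<subseteq> T" using T(1) by (rule span_minimal)
  have AS: "A *v v \<in> span S" if "v \<in> span S" for v
    using that
  proof (induction rule: span_induct_alt)
    case base
    then show ?case by (simp add: span_zero)
  next
    case (step c x y)
    have "A *v x \<in> span S"
    proof (cases "x \<in> g ` F")
      case True
      then show ?thesis by (auto simp: S_def intro!: span_base)
    next
      case False
      then obtain j where j: "j \<in> F" "x = A *v g j" using step(1) by (auto simp: S_def)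
      have "- g j \<in> span S"
        by (rule span_neg, rule span_base) (use j in \<open>simp add: S_def\<close>)
      then show ?thesis by (simp add: j sq)
    qed
    then show ?case
      using step(2) by (simp add: matrix_vector_right_distrib matrix_vector_mult_scaleR span_add span_mul)
  qed
  have "T \<noteq> span S"
    using g(2) insert.prems insert.hyps by (auto simp: S_def)
  then obtain v where v: "v \<in> T" "v \<notin> span S" using ST by blast
  \<comment> \<open>\<open>A\<close> has no real eigenvalue modulo \<open>span S\<close>: if
    \<open>A *v v - c *\<^sub>R v\<close> were in the span, applying \<open>A + c\<close> would put
    \<open>- (1 + c\<^sup>2)\<close> times \<open>v\<close> there.\<close>
  have Av: "A *v v \<notin> span (insert v S)"
  proof
    assume "A *v v \<in> span (insert v S)"
    then obtain c where c: "A *v v - c *\<^sub>R v \<in> span S" by (auto simp: span_insert)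
    then have "A *v (A *v v - c *\<^sub>R v) + c *\<^sub>R (A *v v - c *\<^sub>R v) \<in> span S"
      by (intro span_add span_mul AS)
    then have "- ((1 + c\<^sup>2) *\<^sub>R v) \<in> span S"
      by (simp add: matrix_vector_mult_diff_distrib matrix_vector_mult_scaleR sq algebra_simps power2_eq_square)
    then have "- inverse (1 + c\<^sup>2) *\<^sub>R - ((1 + c\<^sup>2) *\<^sub>R v) \<in> span S"
      by (rule span_mul)
    moreover have "1 + c\<^sup>2 \<noteq> 0" by (smt (verit) zero_le_power2)
    ultimately show False using v(2) by simp
  qed
  define h where "h = g(i := v)"
  have hF: "h ` F = g ` F" "(\<lambda>j. A *v h j) ` F = (\<lambda>j. A *v g j) ` F"
    using insert.hyps by (auto simp: h_def)
  have "h ` insert i F \<union> (\<lambda>i. A *v h i) ` insert i F = insert (A *v v) (insert v S)"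
    unfolding image_insert hF by (auto simp: S_def h_def)
  moreover have "dim (insert (A *v v) (insert v S)) = 2 * card (insert i F)"
    using v(2) Av g(2) insert.hyps by (simp add: dim_insert S_def)
  moreover have "h ` insert i F \<subseteq> T"
    unfolding image_insert hF using g(1) v(1) by (simp add: h_def)
  ultimately show ?case by metis
qed

lemma complex_coordinates:
  fixes A :: "real ^ 'm::finite ^ 'm"
  assumes T: "subspace T" "\<And>v. v \<in> T \<Longrightarrow> A *v v \<in> T" and sq: "\<And>v. A *v (A *v v) = - v"
    and dim: "dim T = 2 * CARD('n::finite)"
  obtains L :: "complex ^ 'n \<Rightarrow> real ^ 'm" where "linear L" "inj L" "range L = T"
    "\<And>z. L (\<i> *s z) = A *v L z"
proof -
  obtain g :: "'n \<Rightarrow> real ^ 'm" where g: "range g \<subseteq> T"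
    "dim (range g \<union> range (\<lambda>i. A *v g i)) = 2 * CARD('n)"
    using complex_structure_basis[OF T sq, of "UNIV :: 'n set"] dim by auto
  define S where "S = range g \<union> range (\<lambda>i. A *v g i)"
  have "S \<subseteq> T" using g T(2) by (auto simp: S_def)
  then have ST: "span S = T"
    using T(1) g(2) dim by (intro subspace_dim_equal) (auto simp: span_minimal S_def)
  define L where "L z = (\<Sum>i\<in>UNIV. Re (z $ i) *\<^sub>R g i + Im (z $ i) *\<^sub>R (A *v g i))" for z :: "complex ^ 'n"
  have L: "linear L"
    by (rule linearI) (simp_all add: L_def scaleR_add_left sum.distrib scaleR_sum_right algebra_simps)
  have Li: "L (\<i> *s z) = A *v L z" for z
    unfolding L_def linear_sum[OF matrix_vector_mul_linear]
    by (rule sum.cong) (simp_all add: matrix_vector_right_distrib matrix_vector_mult_scaleR sq)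
  have Lax: "L (axis i 1) = g i" for i
  proof -
    have "L (axis i 1) = (\<Sum>j\<in>UNIV. if j = i then g j else 0)"
      unfolding L_def by (rule sum.cong) (auto simp: axis_def)
    then show ?thesis by simp
  qed
  have "S \<subseteq> range L"
    using Lax Li by (auto simp: S_def image_iff) metis+
  then have "T \<subseteq> range L"
    unfolding ST[symmetric] by (rule span_minimal) (simp add: L linear_subspace_image)
  moreover have "range L \<subseteq> T"
    using g(1) T by (auto simp: L_def intro!: subspace_sum subspace_add subspace_mul)
  ultimately have ran: "range L = T" by blast
  \<comment> \<open>Injectivity of \<open>L\<close> by dimension: a linear \<open>h\<close> carrying
    \<open>T\<close> onto the coordinate space makes \<open>h \<circ> L\<close> a surjective
    endomorphism, hence injective.\<close>
  have "dim T = dim (UNIV :: (complex ^ 'n) set)"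
    using dim by simp
  then obtain h :: "real ^ 'm \<Rightarrow> complex ^ 'n" where h: "linear h" "h ` T = UNIV"
    using isometries_subspaces[OF T(1) subspace_UNIV] by metis
  have "surj (h \<circ> L)" using h(2) ran by (metis image_comp)
  then have "inj (h \<circ> L)"
    using linear_surjective_imp_injective linear_compose[OF L h(1)] by blast
  then have "inj L" by (rule inj_on_imageI2)
  with L ran Li that show ?thesis by blast
qed

section \<open>Construction of the holomorphic chart\<close>

context acs_section
begin

text \<open>\<open>f p\<close> preserves both summands of the orthogonal splitting, so projecting to
  \<open>TS p\<close> is complex linear for it.\<close>

lemma proj_TS_commute:
  assumes "p \<in> U" shows "proj_TS p (f p *v v) = f p *v proj_TS p v"
  by (simp add: proj_TS_def matrix_vector_mult_diff_distrib matrix_vector_mult_scaleR f_mult[OF assms assms])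

text \<open>With \<open>A = f q\<close> and \<open>A\<^sub>0 = f p\<close>, the graph of \<open>A\<close> is the \<open>-\<i>\<close>-eigenspace of \<open>A\<close>; relative to the
  eigenspace decomposition of \<open>A\<^sub>0\<close> the map \<open>A \<mapsto> (1 - A\<^sub>0 A)\<^sup>-\<^sup>1\<close> is an affine chart of the Grassmannian,
  hence holomorphic.\<close>
lemma holomorphic_imp_integrable:
  assumes hol: "holomorphic_section U f"
  shows "integrable_acs U (J_of f)"
  unfolding integrable_acs_def
proof
  fix p assume p: "p \<in> U"
  let ?A0 = "f p"
  note J0 = f_mult[OF p p]
  have sm: "smooth_on U f" using sec by (simp add: local_section_def)
  obtain O1 F where O1: "open O1" "p \<in> O1" and F: "\<And>k. Ck_on k O1 F"
    and F_eq: "\<And>y. y \<in> U \<inter> O1 \<Longrightarrow> F y = f y"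
    using bspec[OF sm[unfolded smooth_on_def] p] by metis
  obtain O2 where O2: "open O2" "U = S2n \<inter> O2"
    using openU openin_open by metis
  \<comment> \<open>The extension \<open>F\<close> makes \<open>M\<close> smooth on an open subset
    of the ambient space. At \<open>p\<close> it is twice the identity, so it stays invertible
    nearby.\<close>
  define M where "M x = mat 1 - ?A0 ** F x" for x
  have Mv: "M x *v v = v - ?A0 *v (F x *v v)" for x v
    by (simp add: M_def matrix_vector_mult_diff_rdistrib matrix_vector_mul_assoc)
  have lin: "linear (\<lambda>B. - (?A0 ** B))"
    by (rule linearI) (simp_all add: matrix_add_ldistrib matrix_scalar_ac scalar_matrix_assoc flip: scalar_mult_eq_scaleR)
  have Mk: "Ck_on k O1 M" for k
    unfolding M_def diff_conv_add_uminus
    by (intro Ck_on_add[OF O1(1)] Ck_on_const Ck_on_linear_compose[OF O1(1) lin] F)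
  have Mij: "Ck_on k O1 (\<lambda>x. M x $ i $ j)" for k i j
    by (intro Ck_on_vec_nth[OF O1(1)] Mk)
  have "continuous_on O1 (\<lambda>x. det (M x))"
    using Ck_on_det[OF O1(1) Mij, of 0] by simp
  then have "open (O1 \<inter> (\<lambda>x. det (M x)) -` (- {0}))"
    using O1(1) by (intro continuous_open_preimage) auto
  define O3 where "O3 = O2 \<inter> (O1 \<inter> (\<lambda>x. det (M x)) -` (- {0}))"
  have Mp: "M p *v v = 2 *\<^sub>R v" for v
    using F_eq[of p] p O1(2) by (simp add: Mv J0(4) scaleR_2)
  have detp: "det (M p) \<noteq> 0"
  proof -
    have "inj ((*v) (M p))" by (rule injI) (simp add: Mp)
    then show ?thesis
      by (metis invertible_det_nz invertible_left_inverse matrix_left_invertible_injective)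
  qed
  have O3: "open O3" "p \<in> O3" "O3 \<subseteq> O1" "O3 \<subseteq> O2" and det: "\<And>x. x \<in> O3 \<Longrightarrow> det (M x) \<noteq> 0"
    using \<open>open (O1 \<inter> _)\<close> O2 O1(2) p detp by (auto simp: O3_def)
  \<comment> \<open>Of the inverse of \<open>M x\<close> only the value at \<open>e_neg\<close> is
    kept; it already carries enough coordinates. On \<open>O3\<close> the solution is unique, so the
    choice is smooth by \<open>Ck_on_linear_solve\<close>.\<close>
  define a where "a x = (SOME v. M x *v v = e_neg)" for x
  have Ma: "M x *v a x = e_neg" if "x \<in> O3" for x
    unfolding a_def by (rule someI[where P = "\<lambda>v. M x *v v = e_neg"])
      (rule iffD2[OF cramer[OF det[OF that]] refl])
  have M_inj: "v = w" if "x \<in> O3" "M x *v v = M x *v w" for x v w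
    using iffD1[OF cramer[OF det[OF that(1)]] that(2)]
      iffD1[OF cramer[OF det[OF that(1)]] refl, of w] by (rule trans[OF _ sym])
  have ak: "Ck_on k O3 a" for k
    by (rule Ck_on_linear_solve[OF O3(1) Ck_on_subset[OF O1(1) O3(1,3) Mij] Ck_on_const det Ma])
  define D where "D x = frechet_derivative a (at x)" for x
  have hD: "(a has_derivative D x) (at x)" if "x \<in> O3" for x
    unfolding D_def using Ck_on_has_derivative[OF O3(1) ak that] .
  have MD: "M q *v D q X = ?A0 *v (df q X *v a q)" if q: "q \<in> U" "q \<in> O3" and X: "X \<in> TS q" for q X
  proof -
    have a: "(a has_derivative D q) (at q within U)"
      using hD[OF q(2)] by (rule has_derivative_at_withinI)
    have "D q X - ?A0 *v (f q *v D q X + df q X *v a q) = 0"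
    proof (rule differential_unique[OF openin_Int_open[OF openU O3(1)] _ X])
      show "q \<in> U \<inter> O3" using q by simp
      show "((\<lambda>x. a x - ?A0 *v (f x *v a x)) has_derivative
          (\<lambda>X. D q X - ?A0 *v (f q *v D q X + df q X *v a q))) (at q within U \<inter> O3)"
        by (rule has_derivative_subset[OF has_derivative_diff[OF a
              bounded_linear.has_derivative[OF matrix_vector_mul_bounded_linear
                has_derivative_matrix_vector_mult[OF df_has_derivative[OF q(1)] a]]]]) auto
      show "((\<lambda>x. e_neg) has_derivative (\<lambda>X. 0)) (at q within U \<inter> O3)" by simp
      show "a x - ?A0 *v (f x *v a x) = e_neg" if "x \<in> U \<inter> O3" for x
        using Ma[of x] F_eq[of x] that O3(3) by (auto simp: Mv)
    qed
    then show ?thesis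
      using F_eq[of q] q O3(3) by (auto simp: Mv matrix_vector_right_distrib algebra_simps)
  qed
  \<comment> \<open>Complex linearity of the derivative of \<open>a\<close>, tested after applying
    the injective \<open>M q\<close>. Holomorphy pulls \<open>f q\<close> out of
    \<open>df q\<close>, and \<open>MD\<close> multiplied by \<open>?A0\<close> gives
    \<open>df q X *v a q\<close> in terms of \<open>w\<close>.\<close>
  have DJ: "D q (f q *v X) = ?A0 *v D q X" if q: "q \<in> U" "q \<in> O3" and X: "X \<in> TS q" for q X
  proof (rule M_inj[OF q(2)])
    have Fq: "F q = f q" using F_eq q O3(3) by blast
    define w where "w = D q X"
    have "?A0 *v (?A0 *v (df q X *v a q)) = ?A0 *v (w - ?A0 *v (f q *v w))"
      using MD[OF q X] by (simp add: Mv Fq w_def)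
    then have "- (df q X *v a q) = ?A0 *v w + f q *v w"
      by (simp add: J0(4) matrix_vector_mult_diff_distrib)
    then have "- (- (df q X *v a q)) = - (?A0 *v w + f q *v w)" by (simp only:)
    then have "df q X *v a q = - (?A0 *v w) - f q *v w" by simp
    then have "f q *v (df q X *v a q) = w - f q *v (?A0 *v w)"
      by (simp add: matrix_vector_mult_diff_distrib matrix_vector_mult_uminus f_mult(4)[OF q(1,1)])
    then show "M q *v D q (f q *v X) = M q *v (?A0 *v D q X)"
      unfolding MD[OF q f_mult(5)[OF q(1,1) X]] holomorphicD[OF hol q(1) X]
      by (simp add: Mv Fq w_def matrix_vector_mult_diff_distrib)
  qed
  \<comment> \<open>One factor 1/2 comes from inverting \<open>M p\<close>, the other from
    \<open>a p\<close> being half of \<open>e_neg\<close>. So \<open>D p\<close> is injective on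
    \<open>TS p\<close>.\<close>
  have Dp: "D p X = (1 / 4) *\<^sub>R (?A0 *v X)" if X: "X \<in> TS p" for X
  proof -
    have "(1 / 2) *\<^sub>R (M p *v a p) = (1 / 2) *\<^sub>R e_neg" by (simp only: Ma[OF O3(2)])
    then have "a p = (1 / 2) *\<^sub>R e_neg" by (simp add: Mp)
    then have "2 *\<^sub>R D p X = (1 / 2) *\<^sub>R (?A0 *v X)"
      using MD[OF p O3(2) X] by (simp add: Mp matrix_vector_mult_scaleR df_e_neg[OF p X])
    then have "(1 / 2) *\<^sub>R (2 *\<^sub>R D p X) = (1 / 2) *\<^sub>R ((1 / 2) *\<^sub>R (?A0 *v X))" by (simp only:)
    then show ?thesis by simp
  qed
  let ?P = "proj_TS p"
  note lin_P = linear_proj_TS[of p]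
  note bl_P = iffD2[OF linear_linear lin_P]
  \<comment> \<open>The candidate chart \<open>?P (a x)\<close> is completed by two real functions
    that cut out the sphere at the values 0 and 1, so the Euclidean inverse function theorem
    applies. On the sphere \<open>\<Phi> x\<close> is \<open>?P (a x) + p\<close>.\<close>
  define \<Phi> where "\<Phi> x = ?P (a x) + ((x \<bullet> e_neg) *\<^sub>R e_neg + (x \<bullet> x) *\<^sub>R p)" for x
  have \<Phi>k: "Ck_on k O3 \<Phi>" for k
    unfolding \<Phi>_def
    by (intro Ck_on_add[OF O3(1)] Ck_on_linear_compose[OF O3(1) lin_P ak] Ck_on_const
        Ck_on_bilinear[OF O3(1) bounded_bilinear_scaleR] Ck_on_bilinear[OF O3(1) bounded_bilinear_inner]
        Ck_on_linear[OF O3(1)] linear_id[unfolded id_def])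
  have \<Phi>_inner: "\<Phi> x \<bullet> e_neg = x \<bullet> e_neg" "\<Phi> x \<bullet> p = x \<bullet> x" for x
    using TSD[OF proj_TS_in[OF J0(1)], of "a x"] S2nD[OF J0(1)]
    by (simp_all add: \<Phi>_def inner_add_left e_neg_inner)
  have "(\<Phi> has_derivative (\<lambda>h. ?P (D p h) + ((h \<bullet> e_neg) *\<^sub>R e_neg + (p \<bullet> h + h \<bullet> p) *\<^sub>R p))) (at p)"
    unfolding \<Phi>_def
    by (intro has_derivative_add has_derivative_scaleR_left has_derivative_inner_left has_derivative_inner
        has_derivative_ident bounded_linear.has_derivative[OF bl_P hD[OF O3(2)]])
  from frechet_derivative_at[OF this]
  have D\<Phi>: "frechet_derivative \<Phi> (at p) =
    (\<lambda>h. ?P (D p h) + ((h \<bullet> e_neg) *\<^sub>R e_neg + (p \<bullet> h + h \<bullet> p) *\<^sub>R p))" ..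
  \<comment> \<open>The two extra coordinates force a kernel vector into \<open>TS p\<close>, where
    \<open>Dp\<close> finishes.\<close>
  have inj: "inj (frechet_derivative \<Phi> (at p))"
  proof (rule linear_injective_0[THEN iffD2, rule_format])
    show "linear (frechet_derivative \<Phi> (at p))"
      using Ck_on_has_derivative[OF O3(1) \<Phi>k O3(2)] by (rule has_derivative_linear)
    fix h assume 0: "frechet_derivative \<Phi> (at p) h = 0"
    note T = TSD[OF proj_TS_in[OF J0(1)], of "D p h"]
    have "frechet_derivative \<Phi> (at p) h \<bullet> e_neg = h \<bullet> e_neg"
      "frechet_derivative \<Phi> (at p) h \<bullet> p = 2 * (h \<bullet> p)"
      unfolding D\<Phi> using T S2nD[OF J0(1)] by (simp_all add: inner_add_left e_neg_inner inner_commute[of p h])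
    then have h: "h \<bullet> e_neg = 0" "h \<bullet> p = 0" using 0 by auto
    then have hT: "h \<in> TS p" by (rule TSI)
    have "?P (D p h) = 0" using 0 h unfolding D\<Phi> by (simp add: inner_commute[of p h])
    moreover have "D p h \<in> TS p"
      unfolding Dp[OF hT] using J0(5)[OF hT] subspace_TS by (rule subspace_mul[rotated])
    ultimately have "?A0 *v h = 0" using Dp[OF hT] by (simp add: proj_TS_id)
    then show "h = 0" using J0(4)[of h] by simp
  qed
  obtain V' W1 G where V': "open V'" "V' \<subseteq> O3" "p \<in> V'" and W1: "open W1"
    and hom: "homeomorphism V' W1 \<Phi> G" and G: "\<And>k. Ck_on k W1 G"
    by (rule smooth_inverse_function[OF O3(1,2) \<Phi>k inj]) (rule that)
  obtain L :: "complex ^ 'n \<Rightarrow> real ^ 'n ix" where L: "linear L" "inj L" "range L = TS p"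
    and Li: "\<And>z. L (\<i> *s z) = ?A0 *v L z"
    using complex_coordinates[OF subspace_TS J0(5) J0(4) dim_TS[OF J0(1)]] by blast
  obtain K where K: "linear K" "K \<circ> L = id"
    using linear_injective_left_inverse[OF L(1,2)] by blast
  have KL: "K (L z) = z" for z using K(2) by (simp add: pointfree_idE)
  have LK: "L (K t) = t" if "t \<in> TS p" for t
    using that L(3) KL by (metis imageE)
  define V where "V = U \<inter> V'"
  define W where "W = (\<lambda>z. L z + p) -` W1"
  define \<phi> where "\<phi> x = K (?P (a x))" for x
  define \<psi> where "\<psi> z = G (L z + p)" for z
  have L\<phi>: "L (\<phi> x) = ?P (a x)" for x
    unfolding \<phi>_def by (rule LK[OF proj_TS_in[OF J0(1)]])
  have contL: "continuous_on UNIV (\<lambda>z. L z + p)"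
    using L(1) by (intro continuous_intros linear_continuous_on) (simp add: linear_linear)
  have W: "open W" unfolding W_def using contL W1 by (rule open_vimage[rotated])
  have GP: "G (\<Phi> x) = x" "\<Phi> x \<in> W1" if "x \<in> V'" for x
    using hom that unfolding homeomorphism_def by auto
  have PG: "\<Phi> (G y) = y" "G y \<in> V'" if "y \<in> W1" for y
    using hom that unfolding homeomorphism_def by auto
  have \<Phi>V: "L (\<phi> x) + p = \<Phi> x" if "x \<in> V" for x
    using that O2 by (auto simp: V_def \<Phi>_def L\<phi> S2nD)
  have 1: "\<phi> x \<in> W" "\<psi> (\<phi> x) = x" if "x \<in> V" for x
    using \<Phi>V[OF that] GP[of x] that by (auto simp: W_def \<psi>_def V_def)
  \<comment> \<open>\<open>G\<close> carries the slice \<open>p + TS p\<close> back into the sphere,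
    because \<open>\<Phi>_inner\<close> reads both sphere equations off the value of
    \<open>\<Phi>\<close>.\<close>
  have 2: "\<psi> z \<in> V" "\<phi> (\<psi> z) = z" if "z \<in> W" for z
  proof -
    have z: "\<Phi> (\<psi> z) = L z + p" "\<psi> z \<in> V'" using PG that by (auto simp: W_def \<psi>_def)
    have Lz: "L z \<in> TS p" using L(3) by blast
    have "\<psi> z \<bullet> e_neg = 0" "\<psi> z \<bullet> \<psi> z = 1"
      using \<Phi>_inner[of "\<psi> z"] TSD[OF Lz] S2nD[OF J0(1)] unfolding z(1) by (simp_all add: inner_add_left)
    then have "\<psi> z \<in> S2n" by (simp add: S2n_def orthogonal_def norm_eq_1)
    then show V: "\<psi> z \<in> V" using z(2) V'(2) O3(4) O2(2) by (auto simp: V_def)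
    have "L (\<phi> (\<psi> z)) = L z" using \<Phi>V[OF V] z(1) by simp
    then show "\<phi> (\<psi> z) = z" using L(2) by (simp add: inj_eq)
  qed
  have \<phi>k: "Ck_on k O3 \<phi>" for k
    unfolding \<phi>_def
    by (rule Ck_on_linear_compose[OF O3(1) K(1) Ck_on_linear_compose[OF O3(1) lin_P ak]])
  have \<psi>k: "Ck_on k W \<psi>" for k
    unfolding \<psi>_def
    by (rule Ck_on_compose[OF W W1 _ Ck_on_add[OF W Ck_on_linear[OF W L(1)] Ck_on_const] G])
      (auto simp: W_def)
  have VO: "V \<subseteq> O3" using V'(2) by (auto simp: V_def)
  have VS: "openin (top_of_set S2n) V"
    unfolding V_def by (rule openin_Int_open[OF openU V'(1)])
  show "\<exists>V (W :: (complex ^ 'n) set) \<phi> \<psi>.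
      openin (top_of_set U) V \<and> p \<in> V \<and> open W \<and>
      homeomorphism V W \<phi> \<psi> \<and> smooth_on V \<phi> \<and> smooth_on W \<psi> \<and>
      (\<forall>q\<in>V. \<forall>X\<in>TS q. differential V \<phi> q (J_of f q X) = \<i> *s differential V \<phi> q X)"
  proof (intro exI conjI ballI)
    show "openin (top_of_set U) V" unfolding V_def using V'(1) by (rule openin_open_Int)
    show "p \<in> V" using p V'(3) by (simp add: V_def)
    show "open W" by (rule W)
    show "homeomorphism V W \<phi> \<psi>"
    proof (rule homeomorphismI)
      show "continuous_on V \<phi>" using \<phi>k[of 0] VO by (auto intro: continuous_on_subset)
      show "continuous_on W \<psi>" using \<psi>k[of 0] by simp
    qed (use 1 2 in auto)
    show "smooth_on V \<phi>" unfolding smooth_on_def using O3(1) VO \<phi>k by blast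
    show "smooth_on W \<psi>" unfolding smooth_on_def using W \<psi>k by blast
    fix q X assume q: "q \<in> V" and X: "X \<in> TS q"
    have qU: "q \<in> U" "q \<in> O3" using q VO by (auto simp: V_def)
    have d: "differential V \<phi> q Y = K (?P (D q Y))" if "Y \<in> TS q" for Y
    proof (rule differential_eqI[OF VS q that])
      show "(\<phi> has_derivative (\<lambda>Y. K (?P (D q Y)))) (at q within V)"
        unfolding \<phi>_def
        by (rule bounded_linear.has_derivative[OF iffD2[OF linear_linear K(1)]
              bounded_linear.has_derivative[OF bl_P has_derivative_at_withinI[OF hD[OF qU(2)]]]])
    qed
    \<comment> \<open>\<open>K\<close> inverts \<open>L\<close> on \<open>TS p\<close>, so it turns
      \<open>?A0\<close> there into multiplication by \<open>\<i>\<close>.\<close>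
    have "?P (D q X) = L (K (?P (D q X)))" by (rule LK[OF proj_TS_in[OF J0(1)], symmetric])
    then have "K (?A0 *v ?P (D q X)) = \<i> *s K (?P (D q X))" by (metis KL Li)
    then show "differential V \<phi> q (J_of f q X) = \<i> *s differential V \<phi> q X"
      unfolding J_of_def d[OF X] d[OF f_mult(5)[OF qU(1,1) X]] DJ[OF qU X] proj_TS_commute[OF p] .
  qed
qed

end

theorem theorem4p4:
  fixes U :: "(real ^ 'n::finite ix) set"
    and f :: "real ^ 'n ix \<Rightarrow> real ^ 'n ix ^ 'n ix"
  assumes "openin (top_of_set S2n) U"
    and "local_section JS U f"
  shows "(holomorphic_section U f \<longleftrightarrow> local_section JS_tilde U f \<and> integrable_acs U (J_of f))
       \<and> (holomorphic_section U f \<longleftrightarrow> orthogonal_acs U (J_of f) \<and> integrable_acs U (J_of f))"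
proof -
  interpret acs_section U f using assms by unfold_locales
  have "holomorphic_section U f \<longleftrightarrow> local_section JS_tilde U f \<and> integrable_acs U (J_of f)"
    using holomorphic_imp_JS_tilde holomorphic_imp_integrable
      holomorphicI[OF _ integrable_imp_symmetric] by blast
  then show ?thesis by (simp add: orthogonal_acs_iff)
qed

end
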